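(* Consider the mechanical control system with outputs $$(\mathcal{MSO})\qquad \dot x=v,\qquad \dot v=-v^T\Gamma(x)v+e(x)+\sum_{r=1}^m g_r(x)u_r,\qquad y=h(x)=(h_1(x),\ldots,h_m(x))^T,$$ on $\mathrm{T}Q$, and let $x_0\in Q$. The mechanical input-output linearization and decoupling problem (MIOLD-problem) for $(\mathcal{MSO})$ is solvable, locally around $x_0$ and globally in $v\in \mathrm{T}_xQ$, if and only if both of the following conditions hold: (MR1) $(\mathcal{MSO})$ has a well-defined vector relative half-degree $(\nu_1,\ldots,\nu_m)$ around $x_0$, that is, there are integers $\nu_1,\ldots,\nu_m\ge 1$ such that, in a neighborhood of $x_0$, $L_{g_r}L_e^q h_\ell=0$ for $1\le \ell,r\le m$ and $0\le q\le \nu_\ell-2$, and the $m\times m$ matrix $D(x)=\big(L_{g_r}L_e^{\nu_\ell-1}h_\ell\big)(x)$ satisfies $\operatorname{rank} D(x_0)=m$; (MR2) $\nabla(dL_e^q h_\ell)=0$ in a neighborhood of $x_0$, for $1\le \ell\le m$ and $0\le q\le \nu_\ell-2$.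
   Context: All objects are $C^\infty$-smooth. $Q$ is an $n$-dimensional manifold (configuration manifold) with local coordinates $x=(x^1,\ldots,x^n)$, and $(x,v)$ are the induced coordinates on $\mathrm{T}Q$. $\nabla$ is a symmetric affine connection on $Q$ (not necessarily metric) with Christoffel symbols $\Gamma^i_{jk}=\Gamma^i_{kj}$; the $i$-th component of $v^T\Gamma(x)v$ is $\Gamma^i_{jk}(x)v^jv^k$ (summation over repeated indices from $1$ to $n$). $e=e^i\frac{\partial}{\partial x^i}$ and $g_r=g_r^i\frac{\partial}{\partial x^i}$, $1\le r\le m$, are vector fields on $Q$; $h=(h_1,\ldots,h_m):Q\to\mathbb{R}^m$ is a smooth map depending on configurations only; $u=(u_1,\ldots,u_m)\in\mathbb{R}^m$ is the control. Lie derivatives $L_e$, $L_{g_r}$ are those of functions on $Q$. Covariant derivative: for a one-form $\omega=\omega_jdx^j$ on $Q$, $\nabla\omega=\big(\frac{\partial\omega_j}{\partial x^k}-\Gamma^i_{jk}\omega_i\big)dx^j\otimes dx^k$; in particular, for a function $f$, $\nabla df=\big(\frac{\partial^2 f}{\partial x^j\partial x^k}-\Gamma^i_{jk}\frac{\partial f}{\partial x^i}\big)dx^j\otimes dx^k$. Mechanical feedback transformations consist of (i) mechanical diffeomorphisms $(x,v)\mapsto(\tilde x,\tilde v)=\Phi(x,v)=\big(\phi(x),\frac{\partial\phi}{\partial x}(x)v\big)$, where $\phi$ is a diffeomorphism of configuration spaces; (ii) mechanical feedback $u_r=v^T\gamma^r(x)v+\alpha^r(x)+\sum_{s=1}^m\beta^r_s(x)\tilde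 u_s$, where $\gamma^r_{jk}=\gamma^r_{kj}$, $\alpha^r$, $\beta^r_s$ are smooth functions of $x$ and the matrix $\beta(x)=(\beta^r_s(x))$ is invertible. "Locally around $x_0$ and globally in $v$" means that $\phi$ and $(\alpha,\beta,\gamma)$ are defined on some neighborhood $U$ of $x_0$ in $Q$ and the transformation is applied on all of $\mathrm{T}U$. MIOLD-problem: it is solvable if there exist a mechanical diffeomorphism and a mechanical feedback bringing $(\mathcal{MSO})$ into the form, for some integers $\nu_\ell\ge1$, $$y_\ell=\tilde x^1_\ell,\qquad \dot{\tilde x}^j_\ell=\tilde v^j_\ell\ (1\le j\le\nu_\ell),\qquad \dot{\tilde v}^j_\ell=\tilde x^{j+1}_\ell\ (1\le j\le\nu_\ell-1),\qquad \dot{\tilde v}^{\nu_\ell}_\ell=\tilde u_\ell,\qquad 1\le\ell\le m,$$ $$\dot{\tilde x}_{m+1}=\tilde v_{m+1},\qquad \dot{\tilde v}_{m+1}=-\tilde v^T\tilde\Gamma(\tilde x)\tilde v+\tilde e(\tilde x)+\tilde G(\tilde x)\tilde u,$$ where $\tilde x_{m+1}$ is a (possibly empty) vector of functions on $Q$ completing the $\tilde x^j_\ell$ to a local coordinate system $\tilde x$ on $Q$, $\tilde v=\dot{\tilde x}$ is the vector of all velocities, and $\tilde\Gamma,\tilde e,\tilde G$ are smooth, of appropriate sizes. *)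

theory Defs
  imports "HOL-Analysis.Analysis"
begin

section \<open>Smooth maps between Euclidean spaces\<close>

definition iter_partial :: "'a list \<Rightarrow> ('a::euclidean_space \<Rightarrow> 'b::real_normed_vector) \<Rightarrow> 'a \<Rightarrow> 'b"
  where "iter_partial ds f = fold (\<lambda>d g x. frechet_derivative g (at x) d) ds f"

text \<open>Only used for open \<open>S\<close>. Every iterated partial derivative is differentiable, hence also
  continuous, at every point of \<open>S\<close>, so this is \<open>C\<^sup>\<infinity>\<close>.\<close>

definition smooth_on :: "'a set \<Rightarrow> ('a::euclidean_space \<Rightarrow> 'b::real_normed_vector) \<Rightarrow> bool"
  where "smooth_on S f \<longleftrightarrow>
    (\<forall>ds. set ds \<subseteq> Basis \<longrightarrow> (\<forall>x\<in>S. iter_partial ds f differentiable (at x)))"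

definition partial :: "'n::finite \<Rightarrow> (real^'n \<Rightarrow> real) \<Rightarrow> real^'n \<Rightarrow> real"
  where "partial k f x = frechet_derivative f (at x) (axis k 1)"

text \<open>For \<open>B = (B\<^sup>i\<^sub>j\<^sub>k)\<close>, the vector with \<open>i\<close>-th component \<open>B\<^sup>i\<^sub>j\<^sub>k v\<^sup>j w\<^sup>k\<close>.\<close>

definition bilin :: "real^'n^'n^'i \<Rightarrow> real^'n \<Rightarrow> real^'n \<Rightarrow> real^'i::finite"
  where "bilin B v w = (\<chi> i. v \<bullet> (B $ i *v w))"


section \<open>Smooth manifolds, vector fields and affine connections\<close>

text \<open>A chart is a domain together with a coordinate map (whose values off the domain are
  irrelevant). Vector fields and connections are given by their components in all charts of the
  atlas, subject to the usual transformation laws on overlaps.\<close>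

type_synonym ('q, 'n) chart = "'q set \<times> ('q \<Rightarrow> real^'n)"

definition dom_of :: "('q, 'n) chart \<Rightarrow> 'q set"
  where "dom_of C = fst C"

definition coord :: "('q, 'n) chart \<Rightarrow> 'q \<Rightarrow> real^'n"
  where "coord C = snd C"

definition coord_range :: "('q, 'n) chart \<Rightarrow> (real^'n) set"
  where "coord_range C = coord C ` dom_of C"

definition coord_inv :: "('q, 'n) chart \<Rightarrow> real^'n \<Rightarrow> 'q"
  where "coord_inv C = inv_into (dom_of C) (coord C)"

definition transition :: "('q, 'n) chart \<Rightarrow> ('q, 'n) chart \<Rightarrow> real^'n \<Rightarrow> real^'n"
  where "transition C D = coord D \<circ> coord_inv C"

definition smooth_manifold :: "'q topology \<Rightarrow> ('q, 'n::finite) chart set \<Rightarrow> bool"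
  where "smooth_manifold Q A \<longleftrightarrow>
    Hausdorff_space Q \<and> second_countable Q \<and> (\<Union>C\<in>A. dom_of C) = topspace Q \<and>
    (\<forall>C\<in>A. openin Q (dom_of C) \<and> open (coord_range C) \<and>
       homeomorphic_map (subtopology Q (dom_of C)) (top_of_set (coord_range C)) (coord C)) \<and>
    (\<forall>C\<in>A. \<forall>D\<in>A. smooth_on (coord C ` (dom_of C \<inter> dom_of D)) (transition C D))"

definition smooth_map_on_manifold ::
    "('q, 'n::finite) chart set \<Rightarrow> ('q \<Rightarrow> 'b::real_normed_vector) \<Rightarrow> bool"
  where "smooth_map_on_manifold A f \<longleftrightarrow>
    (\<forall>C\<in>A. smooth_on (coord_range C) (f \<circ> coord_inv C))"

definition vector_field ::
    "('q, 'n::finite) chart set \<Rightarrow> (('q, 'n) chart \<Rightarrow> real^'n \<Rightarrow> real^'n) \<Rightarrow> bool"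
  where "vector_field A X \<longleftrightarrow>
    (\<forall>C\<in>A. smooth_on (coord_range C) (X C)) \<and>
    (\<forall>C\<in>A. \<forall>D\<in>A. \<forall>p \<in> dom_of C \<inter> dom_of D.
       X D (coord D p) =
         frechet_derivative (transition C D) (at (coord C p)) (X C (coord C p)))"

text \<open>\<open>\<Gamma> C x $ i $ j $ k\<close> is the Christoffel symbol \<open>\<Gamma>\<^sup>i\<^sub>j\<^sub>k\<close> at \<open>x\<close> in the chart \<open>C\<close>. With \<open>\<tau>\<close> the
  transition map, the transformation law reads
  \<open>\<Gamma>\<^sub>D(\<tau>(x))(\<tau>'(x)v, \<tau>'(x)w) = \<tau>'(x) \<Gamma>\<^sub>C(x)(v, w) - \<tau>''(x)(v, w)\<close>.\<close>

definition symmetric_affine_connection ::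
    "('q, 'n::finite) chart set \<Rightarrow> (('q, 'n) chart \<Rightarrow> real^'n \<Rightarrow> real^'n^'n^'n) \<Rightarrow> bool"
  where "symmetric_affine_connection A \<Gamma> \<longleftrightarrow>
    (\<forall>C\<in>A. smooth_on (coord_range C) (\<Gamma> C)) \<and>
    (\<forall>C\<in>A. \<forall>x\<in>coord_range C. \<forall>i j k. \<Gamma> C x $ i $ j $ k = \<Gamma> C x $ i $ k $ j) \<and>
    (\<forall>C\<in>A. \<forall>D\<in>A. \<forall>p \<in> dom_of C \<inter> dom_of D. \<forall>v w.
       (let \<tau> = transition C D; x = coord C p; d\<tau> = (\<lambda>y. frechet_derivative \<tau> (at y))
        in bilin (\<Gamma> D (\<tau> x)) (d\<tau> x v) (d\<tau> x w) =
             d\<tau> x (bilin (\<Gamma> C x) v w) - frechet_derivative (\<lambda>y. d\<tau> y w) (at x) v))"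


section \<open>Lie and covariant derivatives in local coordinates\<close>

definition lie_deriv :: "(real^'n \<Rightarrow> real^'n) \<Rightarrow> (real^'n \<Rightarrow> real) \<Rightarrow> real^'n::finite \<Rightarrow> real"
  where "lie_deriv X f x = (\<Sum>i\<in>UNIV. X x $ i * partial i f x)"

definition differential :: "(real^'n \<Rightarrow> real) \<Rightarrow> real^'n::finite \<Rightarrow> real^'n"
  where "differential f x = (\<chi> j. partial j f x)"

definition cov_deriv ::
    "(real^'n \<Rightarrow> real^'n^'n^'n) \<Rightarrow> (real^'n \<Rightarrow> real^'n) \<Rightarrow> real^'n::finite \<Rightarrow> real^'n^'n"
  where "cov_deriv \<Gamma> \<omega> x =
    (\<chi> j k. partial k (\<lambda>y. \<omega> y $ j) x - (\<Sum>i\<in>UNIV. \<Gamma> x $ i $ j $ k * \<omega> x $ i))"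


section \<open>Mechanical control systems and mechanical feedback transformations\<close>

definition mech_system ::
    "(real^'n \<Rightarrow> real^'n^'n^'n) \<Rightarrow> (real^'n \<Rightarrow> real^'n) \<Rightarrow> ('m \<Rightarrow> real^'n \<Rightarrow> real^'n) \<Rightarrow>
     (real^'n) \<times> (real^'n) \<Rightarrow> real^'m::finite \<Rightarrow> (real^'n::finite) \<times> (real^'n)"
  where "mech_system \<Gamma> e g = (\<lambda>(x, v) u.
    (v, - bilin (\<Gamma> x) v v + e x + (\<Sum>r\<in>UNIV. u $ r *\<^sub>R g r x)))"

definition diffeo_on :: "(real^'n) set \<Rightarrow> (real^'n \<Rightarrow> real^'n::finite) \<Rightarrow> bool"
  where "diffeo_on V \<phi> \<longleftrightarrow> open V \<and> open (\<phi> ` V) \<and> inj_on \<phi> V \<and>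
    smooth_on V \<phi> \<and> smooth_on (\<phi> ` V) (inv_into V \<phi>)"

definition mech_diffeo ::
    "(real^'n \<Rightarrow> real^'n) \<Rightarrow> (real^'n) \<times> (real^'n) \<Rightarrow> (real^'n::finite) \<times> (real^'n)"
  where "mech_diffeo \<phi> = (\<lambda>(x, v). (\<phi> x, frechet_derivative \<phi> (at x) v))"

definition admissible_feedback ::
    "(real^'n) set \<Rightarrow> (real^'n \<Rightarrow> real^'n^'n^'m) \<Rightarrow> (real^'n \<Rightarrow> real^'m) \<Rightarrow>
     (real^'n::finite \<Rightarrow> real^'m^'m::finite) \<Rightarrow> bool"
  where "admissible_feedback V \<gamma> \<alpha> \<beta> \<longleftrightarrow>
    smooth_on V \<gamma> \<and> smooth_on V \<alpha> \<and> smooth_on V \<beta> \<and>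
    (\<forall>x\<in>V. \<forall>r j k. \<gamma> x $ r $ j $ k = \<gamma> x $ r $ k $ j) \<and> (\<forall>x\<in>V. invertible (\<beta> x))"

definition mech_feedback ::
    "(real^'n \<Rightarrow> real^'n^'n^'m) \<Rightarrow> (real^'n \<Rightarrow> real^'m) \<Rightarrow> (real^'n \<Rightarrow> real^'m^'m) \<Rightarrow>
     (real^'n) \<times> (real^'n) \<Rightarrow> real^'m \<Rightarrow> real^'m::finite"
  where "mech_feedback \<gamma> \<alpha> \<beta> = (\<lambda>(x, v) u'. bilin (\<gamma> x) v v + \<alpha> x + \<beta> x *v u')"

text \<open>The closed-loop vector field, pushed forward by the mechanical diffeomorphism, is \<open>F'\<close>, and
  the output becomes \<open>h'\<close>, for configurations in \<open>V\<close> and all velocities and new controls.\<close>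

definition brings_into ::
    "(real^'n) set \<Rightarrow> (real^'n \<Rightarrow> real^'n) \<Rightarrow>
     (real^'n \<Rightarrow> real^'n^'n^'m) \<Rightarrow> (real^'n \<Rightarrow> real^'m) \<Rightarrow> (real^'n \<Rightarrow> real^'m^'m) \<Rightarrow>
     ((real^'n) \<times> (real^'n) \<Rightarrow> real^'m \<Rightarrow> (real^'n) \<times> (real^'n)) \<Rightarrow> (real^'n \<Rightarrow> real^'m) \<Rightarrow>
     ((real^'n) \<times> (real^'n) \<Rightarrow> real^'m \<Rightarrow> (real^'n) \<times> (real^'n)) \<Rightarrow>
     (real^'n::finite \<Rightarrow> real^'m::finite) \<Rightarrow> bool"
  where "brings_into V \<phi> \<gamma> \<alpha> \<beta> F h F' h' \<longleftrightarrow>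
    (\<forall>x\<in>V. \<forall>v u'.
       frechet_derivative (mech_diffeo \<phi>) (at (x, v)) (F (x, v) (mech_feedback \<gamma> \<alpha> \<beta> (x, v) u')) =
         F' (mech_diffeo \<phi> (x, v)) u') \<and>
    (\<forall>x\<in>V. h' (\<phi> x) = h x)"

text \<open>\<open>idx l j\<close> is the position, among the \<open>n\<close> coordinates, of the \<open>j\<close>-th coordinate of the \<open>l\<close>-th
  chain; the positions not hit by \<open>idx\<close> carry the remaining coordinates, for which alone the rows
  of \<open>\<Gamma>'\<close>, \<open>e'\<close>, \<open>G'\<close> matter.\<close>

definition MIOLD_form ::
    "(real^'n) set \<Rightarrow> ((real^'n) \<times> (real^'n) \<Rightarrow> real^'m \<Rightarrow> (real^'n) \<times> (real^'n)) \<Rightarrow>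
     (real^'n::finite \<Rightarrow> real^'m::finite) \<Rightarrow> bool"
  where "MIOLD_form W F h \<longleftrightarrow>
    (\<exists>(\<nu> :: 'm \<Rightarrow> nat) (idx :: 'm \<Rightarrow> nat \<Rightarrow> 'n)
      (\<Gamma>' :: real^'n \<Rightarrow> real^'n^'n^'n) (e' :: real^'n \<Rightarrow> real^'n) (G' :: real^'n \<Rightarrow> real^'m^'n).
       (\<forall>l. 1 \<le> \<nu> l) \<and>
       inj_on (\<lambda>(l, j). idx l j) (SIGMA l:UNIV. {1..\<nu> l}) \<and>
       smooth_on W \<Gamma>' \<and> smooth_on W e' \<and> smooth_on W G' \<and>
       (\<forall>x\<in>W. \<forall>l. h x $ l = x $ idx l 1) \<and>
       (\<forall>x\<in>W. \<forall>v u.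
          fst (F (x, v) u) = v \<and>
          (\<forall>l j. 1 \<le> j \<and> j < \<nu> l \<longrightarrow> snd (F (x, v) u) $ idx l j = x $ idx l (j + 1)) \<and>
          (\<forall>l. snd (F (x, v) u) $ idx l (\<nu> l) = u $ l) \<and>
          (\<forall>i. i \<notin> (\<lambda>(l, j). idx l j) ` (SIGMA l:UNIV. {1..\<nu> l}) \<longrightarrow>
             snd (F (x, v) u) $ i = (- bilin (\<Gamma>' x) v v + e' x + G' x *v u) $ i)))"

definition MIOLD_solvable ::
    "(real^'n) set \<Rightarrow> (real^'n \<Rightarrow> real^'n^'n^'n) \<Rightarrow> (real^'n \<Rightarrow> real^'n) \<Rightarrow>
     ('m \<Rightarrow> real^'n \<Rightarrow> real^'n) \<Rightarrow> (real^'n \<Rightarrow> real^'m::finite) \<Rightarrow> real^'n::finite \<Rightarrow> bool"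
  where "MIOLD_solvable S \<Gamma> e g h x0 \<longleftrightarrow>
    (\<exists>V \<phi> \<gamma> \<alpha> \<beta> F' h'.
       x0 \<in> V \<and> V \<subseteq> S \<and> diffeo_on V \<phi> \<and> admissible_feedback V \<gamma> \<alpha> \<beta> \<and>
       brings_into V \<phi> \<gamma> \<alpha> \<beta> (mech_system \<Gamma> e g) h F' h' \<and>
       MIOLD_form (\<phi> ` V) F' h')"


section \<open>Conditions on relative half-degree and covariant derivatives\<close>

definition decoupling_matrix ::
    "(real^'n \<Rightarrow> real^'n) \<Rightarrow> ('m \<Rightarrow> real^'n \<Rightarrow> real^'n) \<Rightarrow> (real^'n \<Rightarrow> real^'m) \<Rightarrow>
     ('m \<Rightarrow> nat) \<Rightarrow> real^'n::finite \<Rightarrow> real^'m^'m::finite"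
  where "decoupling_matrix e g h \<nu> x =
    (\<chi> l r. lie_deriv (g r) ((lie_deriv e ^^ (\<nu> l - 1)) (\<lambda>y. h y $ l)) x)"

text \<open>The range \<open>q \<le> \<nu>\<^sub>l - 2\<close> is written \<open>q + 2 \<le> \<nu>\<^sub>l\<close>, to be empty for \<open>\<nu>\<^sub>l = 1\<close>.\<close>

definition vector_relative_half_degree ::
    "(real^'n) set \<Rightarrow> (real^'n \<Rightarrow> real^'n) \<Rightarrow> ('m \<Rightarrow> real^'n \<Rightarrow> real^'n) \<Rightarrow>
     (real^'n \<Rightarrow> real^'m::finite) \<Rightarrow> real^'n::finite \<Rightarrow> ('m \<Rightarrow> nat) \<Rightarrow> bool"
  where "vector_relative_half_degree S e g h x0 \<nu> \<longleftrightarrow>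
    (\<forall>l. 1 \<le> \<nu> l) \<and>
    (\<exists>N. open N \<and> x0 \<in> N \<and> N \<subseteq> S \<and>
       (\<forall>x\<in>N. \<forall>l r q. q + 2 \<le> \<nu> l \<longrightarrow>
          lie_deriv (g r) ((lie_deriv e ^^ q) (\<lambda>y. h y $ l)) x = 0)) \<and>
    rank (decoupling_matrix e g h \<nu> x0) = CARD('m)"

definition covariantly_constant_differentials ::
    "(real^'n) set \<Rightarrow> (real^'n \<Rightarrow> real^'n^'n^'n) \<Rightarrow> (real^'n \<Rightarrow> real^'n) \<Rightarrow>
     (real^'n \<Rightarrow> real^'m::finite) \<Rightarrow> real^'n::finite \<Rightarrow> ('m \<Rightarrow> nat) \<Rightarrow> bool"
  where "covariantly_constant_differentials S \<Gamma> e h x0 \<nu> \<longleftrightarrow>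
    (\<exists>N. open N \<and> x0 \<in> N \<and> N \<subseteq> S \<and>
       (\<forall>x\<in>N. \<forall>l q. q + 2 \<le> \<nu> l \<longrightarrow>
          cov_deriv \<Gamma> (differential ((lie_deriv e ^^ q) (\<lambda>y. h y $ l))) x = 0))"

end

theory Submission
  imports Defs
begin

text \<open>
  Everything happens in one chart. Along a motion of the system, a function \<open>f\<close> of the configuration
  has velocity \<open>df(v)\<close> and acceleration
  \<open>(\<nabla>df)(v,v) + L\<^sub>e f + \<Sum>\<^sub>r u\<^sub>r L\<^bsub>g r\<^esub> f\<close>
  (\<open>mech_diffeo_system_velocity_acceleration\<close>). Hence a mechanical diffeomorphism with components
  \<open>\<phi>\<^sub>i\<close> followed by a mechanical feedback produces exactly these expressions in \<open>\<phi>\<^sub>i\<close>, with the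
  feedback substituted for \<open>u\<close>, and both implications are read off from them.

  Necessity. Inside a chain the acceleration of \<open>\<phi>\<^sub>i\<close> has to be the next coordinate, for all
  velocities and, since a feedback is invertible in the control, for all \<open>u\<close>. A constant polynomial
  in \<open>(v,u)\<close> has no terms of positive degree, so \<open>L\<^bsub>g r\<^esub> \<phi>\<^sub>i = 0\<close>, the quadratic form of
  \<open>\<nabla>d\<phi>\<^sub>i\<close> vanishes, and the next coordinate is \<open>L\<^sub>e \<phi>\<^sub>i\<close>. As \<open>\<nabla>d\<phi>\<^sub>i\<close> is symmetric (the
  connection is, and mixed partial derivatives commute), it vanishes as a tensor. The chain starts
  with \<open>h\<^sub>l\<close>, so it consists of the \<open>L\<^sub>e\<^sup>q h\<^sub>l\<close>. The end of the chains gives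
  \<open>D \<beta> = 1\<close> for the decoupling matrix \<open>D\<close> and the control part \<open>\<beta>\<close> of the feedback.

  Sufficiency. The functions \<open>L\<^sub>e\<^sup>q h\<^sub>l\<close> with \<open>q < \<nu>\<^sub>l\<close> become coordinates once their differentials
  at the base point are known to be linearly independent. Usually this is shown with iterated Lie
  brackets of \<open>e\<close> and \<open>g\<^sub>r\<close>. Here covariant constancy replaces them by powers of a
  single linear map: if \<open>\<nabla>df = 0\<close>, then \<open>d(L\<^sub>e f)(X) = df(\<nabla>\<^sub>X e)\<close>, so with \<open>T X = \<nabla>\<^sub>X e\<close> at
  the base point, \<open>d(L\<^sub>e\<^sup>q h\<^sub>l) = dh\<^sub>l \<circ> T\<^sup>q\<close>. Pairing the differentials with the vectors
  \<open>T\<^sup>k g\<^sub>r\<close> gives a block triangular matrix with copies of \<open>D\<close> on its diagonal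
  (\<open>chain_covectors_independent\<close>). Linear functions complete them to a map with invertible
  Jacobian, and the inverse function theorem in its smooth form (\<open>local_diffeomorphism\<close>) makes it a
  mechanical diffeomorphism. The feedback is found by solving the equations at the chain ends
  for \<open>u\<close>, which is possible because \<open>D\<close> is invertible.
\<close>

section \<open>Smooth functions\<close>

text \<open>Counting derivatives turns smoothness into a statement provable by induction: closure properties
  are shown for all \<open>k\<close> at once, and those of \<open>smooth_on\<close> follow.\<close>

primrec diff_times :: "nat \<Rightarrow> 'a set \<Rightarrow> ('a::euclidean_space \<Rightarrow> 'b::real_normed_vector) \<Rightarrow> bool" where
  "diff_times 0 S f \<longleftrightarrow> (\<forall>x\<in>S. f differentiable at x)"
| "diff_times (Suc k) S f \<longleftrightarrow> (\<forall>x\<in>S. f differentiable at x) \<and>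
     (\<forall>d\<in>Basis. diff_times k S (\<lambda>x. frechet_derivative f (at x) d))"

lemma diff_times_iff_iter_partial:
  "diff_times k S f \<longleftrightarrow>
    (\<forall>ds. set ds \<subseteq> Basis \<and> length ds \<le> k \<longrightarrow> (\<forall>x\<in>S. iter_partial ds f differentiable at x))"
proof (induction k arbitrary: f)
  case 0
  show ?case by (auto simp: iter_partial_def)
next
  case (Suc k)
  have "(\<forall>ds. set ds \<subseteq> Basis \<and> length ds \<le> Suc k \<longrightarrow> P ds) \<longleftrightarrow>
      P [] \<and> (\<forall>d\<in>Basis. \<forall>ds. set ds \<subseteq> Basis \<and> length ds \<le> k \<longrightarrow> P (d # ds))"
    for P :: "'a list \<Rightarrow> bool"
    by (auto, case_tac ds, auto)
  then show ?case
    by (simp add: Suc.IH) (simp add: iter_partial_def)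
qed

lemma smooth_on_iff_diff_times: "smooth_on S f \<longleftrightarrow> (\<forall>k. diff_times k S f)"
  unfolding smooth_on_def diff_times_iff_iter_partial by blast

lemma diff_times_imp_differentiable: "diff_times k S f \<Longrightarrow> x \<in> S \<Longrightarrow> f differentiable at x"
  by (cases k) auto

lemma diff_times_Suc_imp: "diff_times (Suc k) S f \<Longrightarrow> diff_times k S f"
  by (auto simp: diff_times_iff_iter_partial)

lemma smooth_on_imp_differentiable: "smooth_on S f \<Longrightarrow> x \<in> S \<Longrightarrow> f differentiable at x"
  using diff_times_imp_differentiable smooth_on_iff_diff_times by blast

lemma smooth_on_has_derivative:
  "smooth_on S f \<Longrightarrow> x \<in> S \<Longrightarrow> (f has_derivative frechet_derivative f (at x)) (at x)"
  using smooth_on_imp_differentiable frechet_derivative_works by blast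

lemma smooth_on_imp_continuous_on: "smooth_on S f \<Longrightarrow> continuous_on S f"
  by (meson continuous_at_imp_continuous_on differentiable_imp_continuous_within
      smooth_on_imp_differentiable)

lemma smooth_on_directional:
  assumes "smooth_on S f" "d \<in> Basis"
  shows "smooth_on S (\<lambda>x. frechet_derivative f (at x) d)"
  unfolding smooth_on_iff_diff_times
proof
  fix k
  have "diff_times (Suc k) S f" using assms(1) smooth_on_iff_diff_times by blast
  then show "diff_times k S (\<lambda>x. frechet_derivative f (at x) d)" using assms(2) by simp
qed

lemma smooth_on_subset: "smooth_on S f \<Longrightarrow> T \<subseteq> S \<Longrightarrow> smooth_on T f"
  unfolding smooth_on_def by blast

lemma differentiable_cong_open:
  assumes "open S" "\<And>x. x \<in> S \<Longrightarrow> f x = g x" "f differentiable at x" "x \<in> S"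
  shows "g differentiable at x"
  using assms by (meson differentiable_def has_derivative_transform_within_open)

lemma diff_times_cong:
  assumes "open S" "\<And>x. x \<in> S \<Longrightarrow> f x = g x" "diff_times k S f"
  shows "diff_times k S g"
  using assms(2,3)
proof (induction k arbitrary: f g)
  case 0
  then show ?case using differentiable_cong_open[OF assms(1)] by (metis diff_times.simps(1))
next
  case (Suc k)
  have eq: "frechet_derivative f (at x) = frechet_derivative g (at x)" if "x \<in> S" for x
    using Suc.prems that frechet_derivative_transform_within_open[OF _ assms(1)]
    by (metis diff_times.simps(2))
  have "diff_times k S (\<lambda>x. frechet_derivative g (at x) d)" if "d \<in> Basis" for d
    by (rule Suc.IH[of "\<lambda>x. frechet_derivative f (at x) d"]) (use eq that Suc.prems in auto)
  then show ?case
    using Suc.prems differentiable_cong_open[OF assms(1) Suc.prems(1)] by simp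
qed

lemma smooth_on_cong:
  assumes "open S" "\<And>x. x \<in> S \<Longrightarrow> f x = g x" "smooth_on S f"
  shows "smooth_on S g"
  using assms diff_times_cong unfolding smooth_on_iff_diff_times by blast

text \<open>The form of the recursion used for closure properties: it accepts any formula for the derivative,
  not only \<open>frechet_derivative\<close>.\<close>

lemma diff_times_SucI:
  assumes "open S" "\<And>x. x \<in> S \<Longrightarrow> (f has_derivative F x) (at x)"
    "\<And>d. d \<in> Basis \<Longrightarrow> diff_times k S (\<lambda>x. F x d)"
  shows "diff_times (Suc k) S f"
proof -
  have eq: "F x = frechet_derivative f (at x)" if "x \<in> S" for x
    using assms(2) that frechet_derivative_at by blast
  have "diff_times k S (\<lambda>x. frechet_derivative f (at x) d)" if "d \<in> Basis" for d
    by (rule diff_times_cong[OF assms(1) _ assms(3)[OF that]]) (use eq in auto)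
  then show ?thesis using assms(2) by (auto simp: differentiable_def)
qed

lemma diff_times_has_derivative:
  "diff_times k S f \<Longrightarrow> x \<in> S \<Longrightarrow> (f has_derivative frechet_derivative f (at x)) (at x)"
  using diff_times_imp_differentiable frechet_derivative_works by blast

lemma diff_times_const: "open S \<Longrightarrow> diff_times k S (\<lambda>x. c)"
proof (induction k arbitrary: c)
  case (Suc k)
  show ?case by (rule diff_times_SucI[where F="\<lambda>x h. 0"]) (use Suc in auto)
qed simp

lemma diff_times_linear:
  assumes "bounded_linear L" "open S" "diff_times k S f"
  shows "diff_times k S (\<lambda>x. L (f x))"
  using assms(3)
proof (induction k arbitrary: f)
  case 0
  then show ?case
    using bounded_linear.has_derivative[OF assms(1)] unfolding diff_times.simps differentiable_def by blast
next
  case (Suc k)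
  show ?case
  proof (rule diff_times_SucI[OF assms(2)])
    show "((\<lambda>x. L (f x)) has_derivative (\<lambda>h. L (frechet_derivative f (at x) h))) (at x)" if "x \<in> S" for x
      by (rule bounded_linear.has_derivative[OF assms(1) diff_times_has_derivative[OF Suc.prems that]])
  qed (use Suc in auto)
qed

lemma diff_times_add:
  assumes "open S" "diff_times k S f" "diff_times k S g"
  shows "diff_times k S (\<lambda>x. f x + g x)"
  using assms(2,3)
proof (induction k arbitrary: f g)
  case (Suc k)
  show ?case
    by (rule diff_times_SucI[OF assms(1)])
       (auto intro!: has_derivative_add diff_times_has_derivative[OF Suc.prems(1)]
          diff_times_has_derivative[OF Suc.prems(2)] Suc.IH, use Suc.prems in auto)
qed auto

text \<open>The product rule expresses the derivative through products of functions that are one step less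
  differentiable, which is why the induction must range over both factors.\<close>

lemma diff_times_bilinear:
  fixes f :: "'a::euclidean_space \<Rightarrow> 'b::real_normed_vector"
  assumes "bounded_bilinear B" "open S" "diff_times k S f" "diff_times k S g"
  shows "diff_times k S (\<lambda>x. B (f x) (g x))"
  using assms(3,4)
proof (induction k arbitrary: f g)
  case 0
  then show ?case
    using bounded_bilinear.FDERIV[OF assms(1)] unfolding diff_times.simps differentiable_def by blast
next
  case (Suc k)
  note der = bounded_bilinear.FDERIV[OF assms(1) diff_times_has_derivative[OF Suc.prems(1)]
      diff_times_has_derivative[OF Suc.prems(2)]]
  note low = Suc.prems[THEN diff_times_Suc_imp]
  show ?case
  proof (rule diff_times_SucI[OF assms(2) der])
    fix d :: 'a assume "d \<in> Basis"
    then have "diff_times k S (\<lambda>x. frechet_derivative f (at x) d)"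
      "diff_times k S (\<lambda>x. frechet_derivative g (at x) d)"
      using Suc.prems by simp_all
    then show "diff_times k S (\<lambda>x. B (f x) (frechet_derivative g (at x) d) +
        B (frechet_derivative f (at x) d) (g x))"
      by (intro diff_times_add[OF assms(2)] Suc.IH low)
  qed
qed

lemma diff_times_sum:
  assumes "open S" "\<And>i. i \<in> I \<Longrightarrow> diff_times k S (f i)"
  shows "diff_times k S (\<lambda>x. \<Sum>i\<in>I. f i x)"
  using assms(2)
proof (induction I rule: infinite_finite_induct)
  case (insert i I)
  then show ?case by (simp add: diff_times_add[OF assms(1)])
qed (auto intro: diff_times_const[OF assms(1)])

text \<open>By the chain rule, a directional derivative of \<open>g \<circ> f\<close> is a sum of products of derivatives of \<open>f\<close>
  with compositions \<open>\<partial>\<^sub>b g \<circ> f\<close>. The latter are covered by the induction hypothesis since \<open>f\<close> is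
  kept and only \<open>g\<close> is replaced.\<close>

lemma diff_times_compose:
  fixes f :: "'a::euclidean_space \<Rightarrow> 'b::euclidean_space" and g :: "'b \<Rightarrow> 'c::real_normed_vector"
  assumes "open S" "f ` S \<subseteq> T" "diff_times k S f" "diff_times k T g"
  shows "diff_times k S (\<lambda>x. g (f x))"
  using assms(3,4)
proof (induction k arbitrary: g)
  case 0
  then show ?case
    using assms(2) differentiable_chain_at[of f _ g] by (auto simp: o_def)
next
  case (Suc k)
  let ?G = "\<lambda>b y. frechet_derivative g (at y) b"
  let ?F = "\<lambda>x h. \<Sum>b\<in>Basis. (frechet_derivative f (at x) h \<bullet> b) *\<^sub>R ?G b (f x)"
  show ?case
  proof (rule diff_times_SucI[OF assms(1), where F = ?F])
    fix x assume x: "x \<in> S"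
    then have gx: "(g has_derivative frechet_derivative g (at (f x))) (at (f x))"
      using assms(2) diff_times_has_derivative[OF Suc.prems(2)] by blast
    have "((\<lambda>x. g (f x)) has_derivative (\<lambda>h. frechet_derivative g (at (f x)) (frechet_derivative f (at x) h))) (at x)"
      using diff_chain_at[OF diff_times_has_derivative[OF Suc.prems(1) x] gx] by (simp add: o_def)
    moreover have "frechet_derivative g (at (f x)) w = (\<Sum>b\<in>Basis. (w \<bullet> b) *\<^sub>R ?G b (f x))" for w
    proof -
      have lin: "linear (frechet_derivative g (at (f x)))"
        using gx has_derivative_linear by blast
      have "frechet_derivative g (at (f x)) w
          = frechet_derivative g (at (f x)) (\<Sum>b\<in>Basis. (w \<bullet> b) *\<^sub>R b)"
        by (simp add: euclidean_representation)
      then show ?thesis by (simp add: linear_sum[OF lin] linear_scale[OF lin])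
    qed
    ultimately show "((\<lambda>x. g (f x)) has_derivative ?F x) (at x)"
      by (metis (no_types, lifting) ext)
  next
    fix d :: 'a assume d: "d \<in> Basis"
    have 1: "diff_times k S (\<lambda>x. ?G b (f x))" if "b \<in> Basis" for b
      using Suc.IH[of "?G b"] Suc.prems that diff_times_Suc_imp by fastforce
    have 2: "diff_times k S (\<lambda>x. frechet_derivative f (at x) d \<bullet> b)" for b
      using Suc.prems(1) d by (intro diff_times_linear[OF bounded_linear_inner_left assms(1)]) auto
    show "diff_times k S (\<lambda>x. ?F x d)"
      by (intro diff_times_sum[OF assms(1)] diff_times_bilinear[OF bounded_bilinear_scaleR assms(1)] 1 2)
  qed
qed

text \<open>The derivative of inversion is a product of inversions, so each order follows from the previous.\<close>

lemma diff_times_inverse_real: "diff_times k {x::real. x \<noteq> 0} inverse"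
proof (induction k)
  case 0
  show ?case by (auto simp: differentiable_def intro!: exI derivative_eq_intros)
next
  case (Suc k)
  have op: "open {x::real. x \<noteq> 0}" by (simp add: open_Collect_neq)
  show ?case
  proof (rule diff_times_SucI[OF op, where F = "\<lambda>x h. - (inverse x * h * inverse x)"])
    show "diff_times k {x. x \<noteq> 0} (\<lambda>x. - (inverse x * d * inverse x))" for d :: real
      by (intro diff_times_linear[OF bounded_linear_minus[OF bounded_linear_ident] op]
          diff_times_bilinear[OF bounded_bilinear_mult op] Suc diff_times_const[OF op])
  qed (auto intro!: derivative_eq_intros)
qed

lemma smooth_on_const: "open S \<Longrightarrow> smooth_on S (\<lambda>x. c)"
  by (simp add: smooth_on_iff_diff_times diff_times_const)

lemma smooth_on_linear:
  "bounded_linear L \<Longrightarrow> open S \<Longrightarrow> smooth_on S f \<Longrightarrow> smooth_on S (\<lambda>x. L (f x))"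
  by (simp add: smooth_on_iff_diff_times diff_times_linear)

lemma smooth_on_add:
  "open S \<Longrightarrow> smooth_on S f \<Longrightarrow> smooth_on S g \<Longrightarrow> smooth_on S (\<lambda>x. f x + g x)"
  by (simp add: smooth_on_iff_diff_times diff_times_add)

lemma smooth_on_bilinear:
  "bounded_bilinear B \<Longrightarrow> open S \<Longrightarrow> smooth_on S f \<Longrightarrow> smooth_on S g \<Longrightarrow>
    smooth_on S (\<lambda>x. B (f x) (g x))"
  by (simp add: smooth_on_iff_diff_times diff_times_bilinear)

lemma smooth_on_sum:
  "open S \<Longrightarrow> (\<And>i. i \<in> I \<Longrightarrow> smooth_on S (f i)) \<Longrightarrow> smooth_on S (\<lambda>x. \<Sum>i\<in>I. f i x)"
  by (simp add: smooth_on_iff_diff_times diff_times_sum)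

lemma smooth_on_compose:
  fixes f :: "'a::euclidean_space \<Rightarrow> 'b::euclidean_space" and g :: "'b \<Rightarrow> 'c::real_normed_vector"
  shows "open S \<Longrightarrow> f ` S \<subseteq> T \<Longrightarrow> smooth_on S f \<Longrightarrow> smooth_on T g \<Longrightarrow> smooth_on S (\<lambda>x. g (f x))"
  unfolding smooth_on_iff_diff_times using diff_times_compose by blast

lemma smooth_on_ident: "open S \<Longrightarrow> smooth_on S (\<lambda>x. x)"
proof -
  assume S: "open S"
  have "diff_times k S (\<lambda>x. x)" for k
  proof (cases k)
    case (Suc j)
    show ?thesis unfolding Suc
      by (rule diff_times_SucI[OF S, where F = "\<lambda>x h. h"]) (auto intro: diff_times_const[OF S])
  qed simp
  then show ?thesis by (simp add: smooth_on_iff_diff_times)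
qed

lemma smooth_on_minus: "open S \<Longrightarrow> smooth_on S f \<Longrightarrow> smooth_on S (\<lambda>x. - f x)"
  by (rule smooth_on_linear[OF bounded_linear_minus[OF bounded_linear_ident]])

lemma smooth_on_diff:
  "open S \<Longrightarrow> smooth_on S f \<Longrightarrow> smooth_on S g \<Longrightarrow> smooth_on S (\<lambda>x. f x - g x)"
  using smooth_on_add[of S f "\<lambda>x. - g x"] smooth_on_minus by auto

lemma smooth_on_mult:
  fixes f g :: "'a::euclidean_space \<Rightarrow> real"
  shows "open S \<Longrightarrow> smooth_on S f \<Longrightarrow> smooth_on S g \<Longrightarrow> smooth_on S (\<lambda>x. f x * g x)"
  by (rule smooth_on_bilinear[OF bounded_bilinear_mult])

lemma smooth_on_prod:
  fixes f :: "'i \<Rightarrow> 'a::euclidean_space \<Rightarrow> real"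
  assumes "open S" "\<And>i. i \<in> I \<Longrightarrow> smooth_on S (f i)"
  shows "smooth_on S (\<lambda>x. \<Prod>i\<in>I. f i x)"
  using assms(2)
proof (induction I rule: infinite_finite_induct)
  case (insert i I)
  then show ?case by (simp add: smooth_on_mult[OF assms(1)])
qed (auto intro: smooth_on_const[OF assms(1)])

lemma smooth_on_inverse:
  fixes f :: "'a::euclidean_space \<Rightarrow> real"
  assumes "open S" "smooth_on S f" "\<And>x. x \<in> S \<Longrightarrow> f x \<noteq> 0"
  shows "smooth_on S (\<lambda>x. inverse (f x))"
  by (rule smooth_on_compose[where T = "{x. x \<noteq> 0}"])
     (use assms diff_times_inverse_real in \<open>auto simp: smooth_on_iff_diff_times\<close>)

lemma smooth_on_component:
  fixes f :: "'a::euclidean_space \<Rightarrow> 'b::euclidean_space^'i"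
  shows "open S \<Longrightarrow> smooth_on S f \<Longrightarrow> smooth_on S (\<lambda>x. f x $ i)"
  by (rule smooth_on_linear[OF bounded_linear_vec_nth])

lemma smooth_on_vecI:
  fixes f :: "'a::euclidean_space \<Rightarrow> 'b::euclidean_space^'i"
  assumes "open S" "\<And>i. smooth_on S (\<lambda>x. f x $ i)"
  shows "smooth_on S f"
proof -
  have "linear (axis i :: 'b \<Rightarrow> 'b^'i)" for i
    by (rule linearI) (auto simp: axis_def vec_eq_iff)
  then have "bounded_linear (axis i :: 'b \<Rightarrow> 'b^'i)" for i
    by (simp add: linear_conv_bounded_linear)
  then have "smooth_on S (\<lambda>x. \<Sum>i\<in>UNIV. axis i (f x $ i))"
    by (intro smooth_on_sum[OF assms(1)] smooth_on_linear[OF _ assms])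
  moreover have "(\<Sum>i\<in>UNIV. axis i (f x $ i)) = f x" for x
    by (simp add: vec_eq_iff axis_def)
  ultimately show ?thesis by simp
qed

lemma smooth_on_matrix_vector_mult:
  fixes M :: "'a::euclidean_space \<Rightarrow> real^'n^'m"
  assumes "open S" "smooth_on S M" "smooth_on S v"
  shows "smooth_on S (\<lambda>x. M x *v v x)"
  by (rule smooth_on_vecI[OF assms(1)])
     (auto simp: matrix_vector_mult_def intro!: smooth_on_sum smooth_on_mult smooth_on_component assms)

lemma smooth_on_matrix_mult:
  fixes M :: "'a::euclidean_space \<Rightarrow> real^'n^'m" and N :: "'a \<Rightarrow> real^'k^'n"
  assumes "open S" "smooth_on S M" "smooth_on S N"
  shows "smooth_on S (\<lambda>x. M x ** N x)"
  by (intro smooth_on_vecI[OF assms(1)])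
     (auto simp: matrix_matrix_mult_def intro!: smooth_on_sum smooth_on_mult smooth_on_component assms)

lemma smooth_on_det:
  fixes M :: "'a::euclidean_space \<Rightarrow> real^'n^'n"
  assumes "open S" "smooth_on S M"
  shows "smooth_on S (\<lambda>x. det (M x))"
  unfolding det_def
  by (intro smooth_on_sum smooth_on_mult smooth_on_prod smooth_on_component smooth_on_const assms)

section \<open>Matrix inverses and smooth inverse functions\<close>

lemma
  fixes M :: "real^'n^'n"
  assumes "invertible M"
  shows matrix_inv_right: "M ** matrix_inv M = mat 1" and matrix_inv_left: "matrix_inv M ** M = mat 1"
proof -
  have "M ** matrix_inv M = mat 1 \<and> matrix_inv M ** M = mat 1"
    using assms unfolding invertible_def matrix_inv_def by (rule someI_ex)
  then show "M ** matrix_inv M = mat 1" "matrix_inv M ** M = mat 1" by auto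
qed

text \<open>Cramer's rule, showing that the entries of the inverse are rational functions of the entries.\<close>

lemma matrix_inv_entry:
  fixes M :: "real^'n^'n"
  assumes "invertible M"
  shows "matrix_inv M $ k $ l = det (\<chi> i j. if j = k then axis l 1 $ i else M $ i $ j) * inverse (det M)"
proof -
  have "M *v (matrix_inv M *v axis l 1) = axis l 1"
    using assms by (simp add: matrix_vector_mul_assoc matrix_inv_right)
  then have "matrix_inv M *v axis l 1
      = (\<chi> k. det (\<chi> i j. if j = k then axis l 1 $ i else M $ i $ j) / det M)"
    using cramer[of M "matrix_inv M *v axis l 1" "axis l 1"] assms invertible_det_nz by blast
  then have "(matrix_inv M *v axis l 1) $ k = det (\<chi> i j. if j = k then axis l 1 $ i else M $ i $ j) / det M"
    by simp
  then show ?thesis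
    by (simp add: matrix_vector_mult_basis column_def divide_inverse)
qed

lemma smooth_on_matrix_inv:
  fixes M :: "'a::euclidean_space \<Rightarrow> real^'n^'n"
  assumes "open S" "smooth_on S M" "\<And>x. x \<in> S \<Longrightarrow> invertible (M x)"
  shows "smooth_on S (\<lambda>x. matrix_inv (M x))"
proof (intro smooth_on_vecI[OF assms(1)])
  fix k l
  have "smooth_on S (\<lambda>x. (\<chi> i j. if j = k then axis l 1 $ i else M x $ i $ j) :: real^'n^'n)"
  proof (intro smooth_on_vecI[OF assms(1)])
    show "smooth_on S (\<lambda>x. (\<chi> i j. if j = k then axis l 1 $ i else M x $ i $ j) $ i $ j)" for i j
      by (cases "j = k") (simp_all add: smooth_on_const smooth_on_component assms(1,2))
  qed
  then have "smooth_on S (\<lambda>x. det (\<chi> i j. if j = k then axis l 1 $ i else M x $ i $ j) * inverse (det (M x)))"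
    using assms by (intro smooth_on_mult smooth_on_inverse smooth_on_det)
      (auto simp: invertible_det_nz)
  then show "smooth_on S (\<lambda>x. matrix_inv (M x) $ k $ l)"
    by (rule smooth_on_cong[OF assms(1), rotated]) (simp add: matrix_inv_entry assms)
qed

text \<open>A solution of a total differential equation \<open>df = c(f)\<close> with smooth right-hand side is smooth: if
  \<open>f\<close> is \<open>k\<close> times differentiable, then so is \<open>c(f)\<close>, hence \<open>f\<close> is \<open>k + 1\<close> times differentiable.
  The inverse of a smooth map satisfies such an equation.\<close>

lemma smooth_on_autonomous:
  fixes f :: "'a::euclidean_space \<Rightarrow> 'b::euclidean_space"
  assumes "open S" "f ` S \<subseteq> T" "\<And>x. x \<in> S \<Longrightarrow> (f has_derivative (\<lambda>d. c d (f x))) (at x)"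
    and "\<And>d. d \<in> Basis \<Longrightarrow> smooth_on T (c d)"
  shows "smooth_on S f"
  unfolding smooth_on_iff_diff_times
proof
  show "diff_times k S f" for k
  proof (induction k)
    case 0
    then show ?case using assms(3) differentiable_def by auto
  next
    case (Suc k)
    show ?case
      by (rule diff_times_SucI[OF assms(1,3)])
         (use assms(4) in \<open>auto intro!: diff_times_compose[OF assms(1,2) Suc] simp: smooth_on_iff_diff_times\<close>)
  qed
qed

lemma smooth_on_jacobian:
  fixes f :: "real^'n \<Rightarrow> real^'m"
  assumes "open S" "smooth_on S f"
  shows "smooth_on S (\<lambda>x. matrix (frechet_derivative f (at x)))"
proof (intro smooth_on_vecI[OF assms(1)])
  fix i j
  have "smooth_on S (\<lambda>x. frechet_derivative f (at x) (axis j 1))"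
    by (rule smooth_on_directional[OF assms(2)]) (simp add: axis_in_Basis_iff)
  then show "smooth_on S (\<lambda>x. matrix (frechet_derivative f (at x)) $ i $ j)"
    by (simp add: matrix_def smooth_on_component[OF assms(1)])
qed

text \<open>The inverse function theorem gives a differentiable local inverse \<open>k\<close> with
  \<open>dk = (df \<circ> k)\<^sup>-\<^sup>1\<close>. The right-hand side is a smooth function of \<open>k\<close>, so the
  inverse is smooth by the previous bootstrapping.\<close>

lemma local_diffeomorphism:
  fixes f :: "real^'n \<Rightarrow> real^'n"
  assumes "open U" "x0 \<in> U" "smooth_on U f" "inj (frechet_derivative f (at x0))"
  obtains V where "x0 \<in> V" "V \<subseteq> U" "diffeo_on V f"
    "\<And>x. x \<in> V \<Longrightarrow> invertible (matrix (frechet_derivative f (at x)))"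
proof -
  let ?J = "\<lambda>x. matrix (frechet_derivative f (at x))"
  \<comment> \<open>On the open set where the Jacobian is invertible, its inverse is a smooth function of the point.\<close>
  define U1 where "U1 = {x\<in>U. det (?J x) \<noteq> 0}"
  have smJ: "smooth_on U ?J" by (rule smooth_on_jacobian[OF assms(1,3)])
  have lin: "linear (frechet_derivative f (at x))" if "x \<in> U" for x
    using smooth_on_has_derivative[OF assms(3) that] has_derivative_linear by blast
  have app: "?J x *v h = frechet_derivative f (at x) h" if "x \<in> U" for x h
    using lin[OF that] by (simp add: matrix_works)
  have "U1 = U \<inter> (\<lambda>x. det (?J x)) -` (- {0})" by (auto simp: U1_def)
  moreover have "continuous_on U (\<lambda>x. det (?J x))"
    using smooth_on_imp_continuous_on smooth_on_det[OF assms(1) smJ] by blast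
  ultimately have U1: "open U1"
    using continuous_open_preimage[OF _ assms(1), of "\<lambda>x. det (?J x)" "-{0}"] by auto
  have inv: "invertible (?J x)" if "x \<in> U1" for x using that by (simp add: U1_def invertible_det_nz)
  have "inj ((*v) (?J x0))" using assms(4) app[OF assms(2)] by (metis (no_types, lifting) ext)
  then have "invertible (?J x0)"
    by (metis invertible_left_inverse matrix_left_invertible_injective)
  then have x0: "x0 \<in> U1" using assms(2) by (simp add: U1_def invertible_det_nz)
  define f' where "f' x = Blinfun (frechet_derivative f (at x))" for x
  have f': "blinfun_apply (f' x) = frechet_derivative f (at x)" if "x \<in> U" for x
    unfolding f'_def using lin[OF that]
    by (intro bounded_linear_Blinfun_apply) (simp add: linear_conv_bounded_linear)
  have "continuous_on U1 f'"
  proof (rule continuous_on_blinfun_componentwise)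
    fix i :: "real^'n" assume "i \<in> Basis"
    then have "continuous_on U1 (\<lambda>x. frechet_derivative f (at x) i)"
      using smooth_on_directional[OF assms(3)] smooth_on_imp_continuous_on continuous_on_subset
      by (metis (no_types, lifting) U1_def mem_Collect_eq subsetI)
    then show "continuous_on U1 (\<lambda>x. blinfun_apply (f' x) i)"
      by (rule continuous_on_eq) (auto simp: f' U1_def)
  qed
  moreover have "(f has_derivative blinfun_apply (f' x)) (at x)" if "x \<in> U1" for x
    using that smooth_on_has_derivative[OF assms(3)] by (auto simp: f' U1_def)
  moreover have "Blinfun ((*v) (matrix_inv (?J x0))) o\<^sub>L f' x0 = id_blinfun"
  proof (rule blinfun_eqI)
    fix h
    have "bounded_linear ((*v) (matrix_inv (?J x0)))" by simp
    then show "(Blinfun ((*v) (matrix_inv (?J x0))) o\<^sub>L f' x0) h = id_blinfun h"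
      using app[OF assms(2), symmetric] inv[OF x0]
      by (simp add: bounded_linear_Blinfun_apply f'[OF assms(2)] matrix_vector_mul_assoc matrix_inv_left)
  qed
  ultimately obtain V W g g' where V: "open V" "V \<subseteq> U1" "x0 \<in> V" "open W"
    and hom: "homeomorphism V W f g"
    and g: "\<And>y. y \<in> W \<Longrightarrow> (g has_derivative (g' y)) (at y)"
    and g': "\<And>y. y \<in> W \<Longrightarrow> g' y = inv (blinfun_apply (f' (g y)))"
    using inverse_function_theorem[OF U1 _ _ x0, of f f'] by metis
  have W: "W = f ` V" and gW: "g ` W = V" and gf: "\<And>x. x \<in> V \<Longrightarrow> g (f x) = x"
    using hom by (auto simp: homeomorphism_def)
  have inj: "inj_on f V" using gf by (metis inj_onI)
  have VU: "V \<subseteq> U" using V(2) U1_def by auto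
  have smV: "smooth_on V ?J" using smJ VU smooth_on_subset by blast
  have "smooth_on W g"
  proof (rule smooth_on_autonomous[OF V(4)])
    show "g ` W \<subseteq> V" using gW by simp
    show "(g has_derivative (\<lambda>d. matrix_inv (?J (g y)) *v d)) (at y)" if "y \<in> W" for y
    proof -
      have y: "g y \<in> U1" "g y \<in> U" using gW that V(2) VU by auto
      have "inv (blinfun_apply (f' (g y))) = (*v) (matrix_inv (?J (g y)))"
        unfolding f'[OF y(2)]
      proof (rule inv_equality)
        fix h
        show "matrix_inv (?J (g y)) *v frechet_derivative f (at (g y)) h = h"
          using inv[OF y(1)]
          by (simp add: app[OF y(2), symmetric] matrix_vector_mul_assoc matrix_inv_left)
        show "frechet_derivative f (at (g y)) (matrix_inv (?J (g y)) *v h) = h"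
          using inv[OF y(1)]
          by (simp add: app[OF y(2), symmetric] matrix_vector_mul_assoc matrix_inv_right)
      qed
      then show ?thesis using g[OF that] g'[OF that] by simp
    qed
    show "smooth_on V (\<lambda>x. matrix_inv (?J x) *v d)" for d
      using V inv by (intro smooth_on_matrix_vector_mult smooth_on_matrix_inv smV smooth_on_const) auto
  qed
  then have "smooth_on (f ` V) (inv_into V f)"
    unfolding W[symmetric]
    by (rule smooth_on_cong[OF V(4), rotated]) (use W gf inj in auto)
  then have "diffeo_on V f"
    unfolding diffeo_on_def using V W inj assms(3) VU smooth_on_subset by blast
  then show ?thesis using that V inv VU by blast
qed

section \<open>Commuting mixed derivatives\<close>

lemma has_real_derivative_along_line:
  fixes f :: "'a::real_normed_vector \<Rightarrow> real"
  assumes "f differentiable at (y + s *\<^sub>R d)"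
  shows "((\<lambda>t. f (y + t *\<^sub>R d)) has_real_derivative frechet_derivative f (at (y + s *\<^sub>R d)) d) (at s)"
proof -
  have f: "(f has_derivative frechet_derivative f (at (y + s *\<^sub>R d))) (at (y + s *\<^sub>R d))"
    using assms frechet_derivative_works by blast
  have "((\<lambda>t. y + t *\<^sub>R d) has_derivative (\<lambda>t. t *\<^sub>R d)) (at s)"
    by (auto intro!: derivative_eq_intros)
  from diff_chain_at[OF this f]
  have "((\<lambda>t. f (y + t *\<^sub>R d)) has_derivative
      (\<lambda>t. frechet_derivative f (at (y + s *\<^sub>R d)) (t *\<^sub>R d))) (at s)"
    by (simp add: o_def)
  moreover have "frechet_derivative f (at (y + s *\<^sub>R d)) (t *\<^sub>R d)
      = frechet_derivative f (at (y + s *\<^sub>R d)) d * t" for t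
    using linear_scale[OF has_derivative_linear[OF f]] by (simp add: mult.commute)
  ultimately show ?thesis by (simp add: has_field_derivative_def)
qed

text \<open>The mean value theorem, applied first in direction \<open>v\<close> to the increment in direction \<open>w\<close> and then
  in direction \<open>w\<close> to the derivative.\<close>

lemma second_difference_eq_mixed_derivative:
  fixes f :: "'a::real_normed_vector \<Rightarrow> real"
  assumes f: "\<And>y. y \<in> ball x \<rho> \<Longrightarrow> f differentiable at y"
    and f': "\<And>y. y \<in> ball x \<rho> \<Longrightarrow> (\<lambda>y. frechet_derivative f (at y) v) differentiable at y"
    and "norm v = 1" "norm w = 1" "0 < h" "2 * h < \<rho>"
  obtains p where "p \<in> ball x \<rho>"
    "f (x + h *\<^sub>R v + h *\<^sub>R w) - f (x + h *\<^sub>R v) - f (x + h *\<^sub>R w) + f x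
      = h * (h * frechet_derivative (\<lambda>y. frechet_derivative f (at y) v) (at p) w)"
proof -
  let ?D = "\<lambda>y. frechet_derivative f (at y) v"
  have ball: "x + s *\<^sub>R v + t *\<^sub>R w \<in> ball x \<rho>" if "0 \<le> s" "s \<le> h" "0 \<le> t" "t \<le> h" for s t
  proof -
    have "norm (s *\<^sub>R v + t *\<^sub>R w) \<le> s + t"
      using norm_triangle_ineq[of "s *\<^sub>R v" "t *\<^sub>R w"] that assms(3,4) by simp
    then have "norm (s *\<^sub>R v + t *\<^sub>R w) < \<rho>" using that assms(6) by linarith
    moreover have "dist x (x + s *\<^sub>R v + t *\<^sub>R w) = norm (s *\<^sub>R v + t *\<^sub>R w)"
      by (metis add.assoc add_diff_cancel_left' dist_commute dist_norm)
    ultimately show ?thesis by simp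
  qed
  have D: "((\<lambda>s. f ((x + t *\<^sub>R w) + s *\<^sub>R v)) has_real_derivative ?D (x + s *\<^sub>R v + t *\<^sub>R w)) (at s)"
    if "0 \<le> s" "s \<le> h" "0 \<le> t" "t \<le> h" for s t
  proof -
    have eq: "x + t *\<^sub>R w + s *\<^sub>R v = x + s *\<^sub>R v + t *\<^sub>R w" by simp
    show ?thesis
      using has_real_derivative_along_line[of f "x + t *\<^sub>R w" s v] f[OF ball[OF that]] unfolding eq .
  qed
  have "\<exists>z. 0 < z \<and> z < h \<and>
      (f ((x + h *\<^sub>R w) + h *\<^sub>R v) - f ((x + 0 *\<^sub>R w) + h *\<^sub>R v)) -
      (f ((x + h *\<^sub>R w) + 0 *\<^sub>R v) - f ((x + 0 *\<^sub>R w) + 0 *\<^sub>R v))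
      = (h - 0) * (?D (x + z *\<^sub>R v + h *\<^sub>R w) - ?D (x + z *\<^sub>R v + 0 *\<^sub>R w))"
    using assms(5) by (intro MVT2 DERIV_diff D) auto
  then obtain z where z: "0 < z" "z < h" and
    eq1: "f (x + h *\<^sub>R v + h *\<^sub>R w) - f (x + h *\<^sub>R v) - f (x + h *\<^sub>R w) + f x
      = h * (?D (x + z *\<^sub>R v + h *\<^sub>R w) - ?D (x + z *\<^sub>R v))"
    by (auto simp: algebra_simps)
  have "\<exists>t. 0 < t \<and> t < h \<and> ?D ((x + z *\<^sub>R v) + h *\<^sub>R w) - ?D ((x + z *\<^sub>R v) + 0 *\<^sub>R w)
      = (h - 0) * frechet_derivative ?D (at ((x + z *\<^sub>R v) + t *\<^sub>R w)) w"
    using z assms(5) by (intro MVT2 has_real_derivative_along_line f' ball) auto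
  then obtain t where "0 < t" "t < h" and
    eq2: "?D (x + z *\<^sub>R v + h *\<^sub>R w) - ?D (x + z *\<^sub>R v)
      = h * frechet_derivative ?D (at (x + z *\<^sub>R v + t *\<^sub>R w)) w"
    by auto
  then show ?thesis using that[of "x + z *\<^sub>R v + t *\<^sub>R w"] ball[of z t] z eq1 by simp
qed

text \<open>The second difference is symmetric in \<open>v\<close> and \<open>w\<close>, so by the preceding lemma the two mixed
  derivatives agree at points arbitrarily close to \<open>x\<close>; continuity carries this to \<open>x\<close>.\<close>

lemma mixed_derivatives_commute:
  fixes f :: "'a::euclidean_space \<Rightarrow> real"
  assumes "open S" "x \<in> S" "smooth_on S f" "v \<in> Basis" "w \<in> Basis"
  shows "frechet_derivative (\<lambda>y. frechet_derivative f (at y) v) (at x) w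
       = frechet_derivative (\<lambda>y. frechet_derivative f (at y) w) (at x) v" (is "?A x = ?B x")
proof (rule ccontr)
  assume ne: "?A x \<noteq> ?B x"
  define \<epsilon> where "\<epsilon> = \<bar>?A x - ?B x\<bar> / 2"
  have \<epsilon>: "\<epsilon> > 0" using ne by (simp add: \<epsilon>_def)
  have cont: "continuous (at x) ?A" "continuous (at x) ?B"
    using smooth_on_directional[OF smooth_on_directional[OF assms(3,4)] assms(5)]
      smooth_on_directional[OF smooth_on_directional[OF assms(3,5)] assms(4)]
      smooth_on_imp_continuous_on continuous_on_eq_continuous_at[OF assms(1)] assms(2)
    by blast+
  obtain r1 where r1: "r1 > 0" "\<And>y. dist y x < r1 \<Longrightarrow> dist (?A y) (?A x) < \<epsilon>"
    using cont(1) \<epsilon> unfolding continuous_at_eps_delta by blast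
  obtain r2 where r2: "r2 > 0" "\<And>y. dist y x < r2 \<Longrightarrow> dist (?B y) (?B x) < \<epsilon>"
    using cont(2) \<epsilon> unfolding continuous_at_eps_delta by blast
  obtain r3 where r3: "r3 > 0" "ball x r3 \<subseteq> S"
    using assms(1,2) openE by blast
  define \<rho> where "\<rho> = min r1 (min r2 r3)"
  have \<rho>: "\<rho> > 0" "\<rho> \<le> r1" "\<rho> \<le> r2" "ball x \<rho> \<subseteq> S" using r1 r2 r3 by (auto simp: \<rho>_def)
  \<comment> \<open>Any step with \<open>2 * h < \<rho>\<close> keeps the parallelogram spanned by \<open>h v\<close> and \<open>h w\<close> inside the ball.\<close>
  define h where "h = \<rho> / 3"
  have h: "h > 0" "2 * h < \<rho>" using \<rho> by (auto simp: h_def)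
  have diff: "f differentiable at y" "(\<lambda>y. frechet_derivative f (at y) b) differentiable at y"
    if "y \<in> ball x \<rho>" "b \<in> Basis" for y b
    using that \<rho>(4) smooth_on_imp_differentiable smooth_on_directional assms(3) by blast+
  obtain p where p: "p \<in> ball x \<rho>"
    "f (x + h *\<^sub>R v + h *\<^sub>R w) - f (x + h *\<^sub>R v) - f (x + h *\<^sub>R w) + f x = h * (h * ?A p)"
    using second_difference_eq_mixed_derivative[of x \<rho> f v w h] diff assms(4,5) h by auto
  obtain q where q: "q \<in> ball x \<rho>"
    "f (x + h *\<^sub>R w + h *\<^sub>R v) - f (x + h *\<^sub>R w) - f (x + h *\<^sub>R v) + f x = h * (h * ?B q)"
    using second_difference_eq_mixed_derivative[of x \<rho> f w v h] diff assms(4,5) h by auto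
  have "x + h *\<^sub>R w + h *\<^sub>R v = x + h *\<^sub>R v + h *\<^sub>R w" by (simp add: ac_simps)
  then have "h * (h * ?A p) = h * (h * ?B q)"
    by (simp only: p(2)[symmetric] q(2)[symmetric])
  then have "?A p = ?B q" using h by simp
  moreover have "dist (?A p) (?A x) < \<epsilon>" using r1(2)[of p] p(1) \<rho>(2) by (simp add: dist_commute)
  moreover have "dist (?B q) (?B x) < \<epsilon>" using r2(2)[of q] q(1) \<rho>(3) by (simp add: dist_commute)
  moreover have "a = b \<Longrightarrow> \<bar>a - c\<bar> < \<bar>c - d\<bar> / 2 \<Longrightarrow> \<bar>b - d\<bar> < \<bar>c - d\<bar> / 2 \<Longrightarrow> False"
    for a b c d :: real using abs_triangle_ineq[of "c - a" "a - d"] by (simp add: abs_minus_commute)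
  ultimately show False unfolding \<epsilon>_def dist_real_def by blast
qed

section \<open>Lie derivatives, covariant derivatives and accelerations\<close>

lemma frechet_derivative_eq_differential:
  fixes f :: "real^'n \<Rightarrow> real"
  assumes "f differentiable at x"
  shows "frechet_derivative f (at x) h = differential f x \<bullet> h"
proof -
  have lin: "linear (frechet_derivative f (at x))"
    using assms frechet_derivative_works has_derivative_linear by blast
  have "frechet_derivative f (at x) h = frechet_derivative f (at x) (\<Sum>k\<in>UNIV. h $ k *\<^sub>R axis k 1)"
    by (metis basis_expansion scalar_mult_eq_scaleR)
  then show ?thesis
    by (simp add: linear_sum[OF lin] linear_scale[OF lin] differential_def partial_def inner_vec_def mult.commute)
qed

lemma lie_deriv_eq_inner: "lie_deriv X f x = differential f x \<bullet> X x"
  by (simp add: lie_deriv_def differential_def inner_vec_def mult.commute)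

lemma frechet_derivative_component:
  fixes f :: "real^'n \<Rightarrow> real^'m"
  assumes "f differentiable at x"
  shows "frechet_derivative f (at x) h $ i = frechet_derivative (\<lambda>y. f y $ i) (at x) h"
proof -
  have "((\<lambda>y. f y $ i) has_derivative (\<lambda>h. frechet_derivative f (at x) h $ i)) (at x)"
    using assms bounded_linear.has_derivative[OF bounded_linear_vec_nth] frechet_derivative_works by blast
  then show ?thesis by (metis frechet_derivative_at)
qed

lemma smooth_on_partial: "smooth_on S f \<Longrightarrow> smooth_on S (partial k f)"
  unfolding partial_def by (rule smooth_on_directional) (simp_all add: axis_in_Basis_iff)

lemma smooth_on_lie_deriv:
  "open S \<Longrightarrow> smooth_on S X \<Longrightarrow> smooth_on S f \<Longrightarrow> smooth_on S (lie_deriv X f)"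
  unfolding lie_deriv_def
  by (intro smooth_on_sum smooth_on_mult smooth_on_component smooth_on_partial)

lemma smooth_on_lie_deriv_funpow:
  "open S \<Longrightarrow> smooth_on S X \<Longrightarrow> smooth_on S f \<Longrightarrow> smooth_on S ((lie_deriv X ^^ q) f)"
  by (induction q) (auto intro: smooth_on_lie_deriv)

lemma smooth_on_cov_deriv_differential:
  assumes "open S" "smooth_on S \<Gamma>" "smooth_on S f"
  shows "smooth_on S (cov_deriv \<Gamma> (differential f))"
proof (intro smooth_on_vecI[OF assms(1)])
  fix j k
  show "smooth_on S (\<lambda>x. cov_deriv \<Gamma> (differential f) x $ j $ k)"
    by (simp add: cov_deriv_def differential_def,
        intro smooth_on_diff smooth_on_sum smooth_on_mult smooth_on_partial)
       (auto intro!: assms smooth_on_component smooth_on_partial)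
qed

lemma partial_cong_open:
  assumes "open S" "x \<in> S" "f differentiable at x" "\<And>y. y \<in> S \<Longrightarrow> f y = g y"
  shows "partial k f x = partial k g x"
  unfolding partial_def using frechet_derivative_transform_within_open[OF assms(3,1,2,4)] by simp

definition hessian :: "(real^'n \<Rightarrow> real) \<Rightarrow> real^'n::finite \<Rightarrow> real^'n^'n"
  where "hessian f x = (\<chi> j k. partial k (partial j f) x)"

text \<open>The form in which the covariant derivative meets the dynamics: the Christoffel term is \<open>df\<close> applied
  to the bilinear expression that occurs in the equations of motion.\<close>

lemma inner_cov_deriv_differential:
  "v \<bullet> (cov_deriv \<Gamma> (differential f) x *v w)
    = v \<bullet> (hessian f x *v w) - differential f x \<bullet> bilin (\<Gamma> x) v w"
proof -
  let ?G = "(\<chi> j k. \<Sum>p\<in>UNIV. \<Gamma> x $ p $ j $ k * differential f x $ p) :: real^'a^'a"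
  have "differential f x \<bullet> bilin (\<Gamma> x) v w
      = (\<Sum>p\<in>UNIV. \<Sum>j\<in>UNIV. \<Sum>k\<in>UNIV. v $ j * (\<Gamma> x $ p $ j $ k * differential f x $ p * w $ k))"
    by (simp add: inner_vec_def bilin_def matrix_vector_mult_def sum_distrib_left mult_ac)
  also have "\<dots> = (\<Sum>j\<in>UNIV. \<Sum>p\<in>UNIV. \<Sum>k\<in>UNIV. v $ j * (\<Gamma> x $ p $ j $ k * differential f x $ p * w $ k))"
    by (rule sum.swap)
  also have "\<dots> = (\<Sum>j\<in>UNIV. \<Sum>k\<in>UNIV. \<Sum>p\<in>UNIV. v $ j * (\<Gamma> x $ p $ j $ k * differential f x $ p * w $ k))"
    by (intro sum.cong refl sum.swap)
  also have "\<dots> = v \<bullet> (?G *v w)"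
    by (simp add: inner_vec_def matrix_vector_mult_def sum_distrib_left sum_distrib_right mult_ac)
  finally have "differential f x \<bullet> bilin (\<Gamma> x) v w = v \<bullet> (?G *v w)" .
  moreover have "cov_deriv \<Gamma> (differential f) x = hessian f x - ?G"
    by (simp add: vec_eq_iff cov_deriv_def hessian_def differential_def)
  ultimately show ?thesis
    by (simp add: matrix_vector_mult_diff_rdistrib inner_diff_right)
qed

text \<open>The Leibniz rule \<open>d(df(e))(X) = df(\<nabla>\<^sub>X e) + (\<nabla>df)(e,X)\<close>. When \<open>\<nabla>df = 0\<close>, the differential of
  \<open>L\<^sub>e f\<close> is that of \<open>f\<close> composed with \<open>X \<mapsto> \<nabla>\<^sub>X e\<close>, which propagates along a chain.\<close>

lemma inner_differential_lie_deriv: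
  fixes f :: "real^'n \<Rightarrow> real"
  assumes "open S" "x \<in> S" "smooth_on S f" "smooth_on S e"
  shows "differential (lie_deriv e f) x \<bullet> X
    = differential f x \<bullet> (frechet_derivative e (at x) X + bilin (\<Gamma> x) (e x) X)
      + e x \<bullet> (cov_deriv \<Gamma> (differential f) x *v X)"
proof -
  have sm: "smooth_on S (\<lambda>y. e y $ i)" "smooth_on S (partial i f)" for i
    using assms by (auto intro: smooth_on_component smooth_on_partial)
  have "(lie_deriv e f has_derivative
      (\<lambda>h. \<Sum>i\<in>UNIV. e x $ i * frechet_derivative (partial i f) (at x) h
        + frechet_derivative (\<lambda>y. e y $ i) (at x) h * partial i f x)) (at x)"
    unfolding lie_deriv_def
    by (intro has_derivative_sum has_derivative_mult smooth_on_has_derivative[OF sm(1) assms(2)]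
        smooth_on_has_derivative[OF sm(2) assms(2)])
  note der = frechet_derivative_at[OF this, symmetric]
  have "differential (lie_deriv e f) x \<bullet> X = frechet_derivative (lie_deriv e f) (at x) X"
    using smooth_on_lie_deriv[OF assms(1,4,3)] assms(2)
    by (simp add: frechet_derivative_eq_differential smooth_on_imp_differentiable)
  also have "\<dots> = (\<Sum>i\<in>UNIV. e x $ i * (differential (partial i f) x \<bullet> X))
      + (\<Sum>i\<in>UNIV. frechet_derivative e (at x) X $ i * partial i f x)"
    by (simp add: der sum.distrib
        frechet_derivative_component[OF smooth_on_imp_differentiable[OF assms(4,2)]]
        frechet_derivative_eq_differential[OF smooth_on_imp_differentiable[OF sm(2) assms(2)]])
  also have "(\<Sum>i\<in>UNIV. e x $ i * (differential (partial i f) x \<bullet> X)) = e x \<bullet> (hessian f x *v X)"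
    by (simp add: inner_vec_def matrix_vector_mult_def differential_def hessian_def)
  also have "(\<Sum>i\<in>UNIV. frechet_derivative e (at x) X $ i * partial i f x)
      = differential f x \<bullet> frechet_derivative e (at x) X"
    by (simp add: inner_vec_def differential_def mult.commute)
  finally show ?thesis
    by (simp add: inner_cov_deriv_differential inner_add_right)
qed

lemma cov_deriv_differential_symmetric:
  assumes "open S" "x \<in> S" "smooth_on S f" "\<And>i j k. \<Gamma> x $ i $ j $ k = \<Gamma> x $ i $ k $ j"
  shows "cov_deriv \<Gamma> (differential f) x $ j $ k = cov_deriv \<Gamma> (differential f) x $ k $ j"
  using mixed_derivatives_commute[OF assms(1-3), of "axis j 1" "axis k 1"] assms(4)
  by (simp add: cov_deriv_def differential_def partial_def axis_in_Basis_iff)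

text \<open>By polarization.\<close>

lemma symmetric_quadratic_form_zero:
  fixes M :: "real^'n^'n"
  assumes sym: "\<And>j k. M $ j $ k = M $ k $ j" and zero: "\<And>v. v \<bullet> (M *v v) = 0"
  shows "M = 0"
proof -
  have ax: "axis j 1 \<bullet> (M *v axis k 1) = M $ j $ k" for j k
    by (simp add: inner_axis' matrix_vector_mult_basis column_def)
  have "M $ j $ k = 0" for j k
  proof -
    have "0 = (axis j 1 + axis k 1) \<bullet> (M *v (axis j 1 + axis k 1))" using zero by simp
    also have "\<dots> = M $ j $ j + M $ k $ k + (M $ j $ k + M $ k $ j)"
      by (simp add: matrix_vector_right_distrib inner_add_left inner_add_right ax)
    also have "\<dots> = 2 * M $ j $ k"
      using zero[of "axis j 1"] zero[of "axis k 1"] sym[of k j] by (simp add: ax)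
    finally show ?thesis by simp
  qed
  then show ?thesis by (simp add: vec_eq_iff)
qed

text \<open>The pushed-forward velocity and acceleration. Differentiating \<open>d\<phi>\<^sub>i(x) v\<close> along the system gives
  \<open>\<phi>\<^sub>i''(v,v) + d\<phi>\<^sub>i(-\<Gamma>(v,v) + e + \<Sum>\<^sub>r u\<^sub>r g\<^sub>r)\<close>, and the Christoffel term turns the second derivative
  into the covariant one. Both directions of the theorem compare coefficients in this formula.\<close>

lemma mech_diffeo_system_velocity_acceleration:
  fixes \<phi> :: "real^'n \<Rightarrow> real^'n" and \<Gamma> :: "real^'n \<Rightarrow> real^'n^'n^'n"
    and e :: "real^'n \<Rightarrow> real^'n" and g :: "'m::finite \<Rightarrow> real^'n \<Rightarrow> real^'n" and v :: "real^'n" and u :: "real^'m"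
  assumes "open S" "x \<in> S" "smooth_on S \<phi>"
  defines "Z \<equiv> frechet_derivative (mech_diffeo \<phi>) (at (x, v)) (mech_system \<Gamma> e g (x, v) u)"
  shows "fst Z = frechet_derivative \<phi> (at x) v"
    and "snd Z $ i = v \<bullet> (cov_deriv \<Gamma> (differential (\<lambda>y. \<phi> y $ i)) x *v v)
      + lie_deriv e (\<lambda>y. \<phi> y $ i) x + (\<Sum>r\<in>UNIV. u $ r * lie_deriv (g r) (\<lambda>y. \<phi> y $ i) x)"
proof -
  let ?f = "\<lambda>i y. \<phi> y $ i"
  let ?H = "\<lambda>i. hessian (?f i) x"
  have smi: "smooth_on S (?f i)" for i by (rule smooth_on_component[OF assms(1,3)])
  have smp: "smooth_on S (partial k (?f i))" for i k by (rule smooth_on_partial[OF smi])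
  have D1: "frechet_derivative \<phi> (at y) w = (\<chi> i. \<Sum>k\<in>UNIV. w $ k * partial k (?f i) y)" if "y \<in> S" for y w
  proof -
    have "frechet_derivative \<phi> (at y) w $ i = differential (?f i) y \<bullet> w" for i
      using frechet_derivative_component[OF smooth_on_imp_differentiable[OF assms(3) that]]
        frechet_derivative_eq_differential[OF smooth_on_imp_differentiable[OF smi that]] by simp
    then show ?thesis by (simp add: vec_eq_iff inner_vec_def differential_def mult.commute)
  qed
  let ?M = "\<lambda>z::(real^'n)\<times>(real^'n). (\<phi> (fst z), (\<chi> i. \<Sum>k\<in>UNIV. snd z $ k * partial k (?f i) (fst z)))"
  have fx: "(\<phi> has_derivative frechet_derivative \<phi> (at x)) (at x)"
    by (rule smooth_on_has_derivative[OF assms(3,2)])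
  have px: "(partial k (?f i) has_derivative (\<lambda>h. differential (partial k (?f i)) x \<bullet> h)) (at x)" for i k
    using smooth_on_has_derivative[OF smp assms(2)]
      frechet_derivative_eq_differential[OF smooth_on_imp_differentiable[OF smp assms(2)]]
    by (metis (no_types, lifting) ext)
  have dfst: "(fst has_derivative fst) (at (x, v))" and dsnd: "(snd has_derivative snd) (at (x, v))"
    by (auto intro!: derivative_eq_intros)
  have c1: "((\<lambda>z. \<phi> (fst z)) has_derivative (\<lambda>h. frechet_derivative \<phi> (at x) (fst h))) (at (x, v))"
    using diff_chain_at[OF dfst, of \<phi>] fx by (simp add: o_def)
  have c2: "((\<lambda>z. partial k (?f i) (fst z)) has_derivative (\<lambda>h. differential (partial k (?f i)) x \<bullet> fst h)) (at (x, v))" for i k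
    using diff_chain_at[OF dfst, of "partial k (?f i)"] px by (simp add: o_def)
  have c3: "((\<lambda>z. snd z $ k) has_derivative (\<lambda>h. snd h $ k)) (at (x, v))" for k
    using bounded_linear.has_derivative[OF bounded_linear_vec_nth dsnd] by simp
  have c4: "((\<lambda>z. (\<chi> i. \<Sum>k\<in>UNIV. snd z $ k * partial k (?f i) (fst z)) :: real^'n) has_derivative
     (\<lambda>h. \<chi> i. \<Sum>k\<in>UNIV. v $ k * (differential (partial k (?f i)) x \<bullet> fst h) + snd h $ k * partial k (?f i) x)) (at (x, v))"
  proof (subst has_derivative_componentwise_within, clarsimp simp: Basis_vec_def inner_axis)
    fix i
    show "((\<lambda>z. \<Sum>k\<in>UNIV. snd z $ k * partial k (?f i) (fst z)) has_derivative
       (\<lambda>h. \<Sum>k\<in>UNIV. v $ k * (differential (partial k (?f i)) x \<bullet> fst h) + snd h $ k * partial k (?f i) x)) (at (x, v))"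
      using has_derivative_mult[OF c3 c2] by (intro has_derivative_sum) simp
  qed
  have "(?M has_derivative (\<lambda>h. (frechet_derivative \<phi> (at x) (fst h),
     \<chi> i. \<Sum>k\<in>UNIV. v $ k * (differential (partial k (?f i)) x \<bullet> fst h) + snd h $ k * partial k (?f i) x))) (at (x, v))"
    by (rule has_derivative_Pair[OF c1 c4])
  then have "(mech_diffeo \<phi> has_derivative (\<lambda>h. (frechet_derivative \<phi> (at x) (fst h),
     \<chi> i. \<Sum>k\<in>UNIV. v $ k * (differential (partial k (?f i)) x \<bullet> fst h) + snd h $ k * partial k (?f i) x))) (at (x, v))"
    by (rule has_derivative_transform_within_open[where s = "S \<times> UNIV"])
       (use assms D1 in \<open>auto simp: open_Times mech_diffeo_def\<close>)
  note der = frechet_derivative_at[OF this, symmetric]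
  show "fst Z = frechet_derivative \<phi> (at x) v"
    by (simp add: Z_def der mech_system_def)
  let ?a = "- bilin (\<Gamma> x) v v + e x + (\<Sum>r\<in>UNIV. u $ r *\<^sub>R g r x)"
  have "snd Z $ i = (\<Sum>k\<in>UNIV. v $ k * (differential (partial k (?f i)) x \<bullet> v)) + differential (?f i) x \<bullet> ?a"
    by (simp add: Z_def der mech_system_def sum.distrib inner_vec_def differential_def mult.commute)
  also have "(\<Sum>k\<in>UNIV. v $ k * (differential (partial k (?f i)) x \<bullet> v)) = v \<bullet> (?H i *v v)"
    by (simp add: inner_vec_def matrix_vector_mult_def differential_def hessian_def mult.commute)
  also have "differential (?f i) x \<bullet> ?a = - (differential (?f i) x \<bullet> bilin (\<Gamma> x) v v)
      + lie_deriv e (?f i) x + (\<Sum>r\<in>UNIV. u $ r * lie_deriv (g r) (?f i) x)"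
    by (simp add: lie_deriv_eq_inner inner_add_right inner_diff_right inner_sum_right)
  finally show "snd Z $ i = v \<bullet> (cov_deriv \<Gamma> (differential (?f i)) x *v v)
      + lie_deriv e (?f i) x + (\<Sum>r\<in>UNIV. u $ r * lie_deriv (g r) (?f i) x)"
    by (simp add: inner_cov_deriv_differential)
qed

section \<open>Linear algebra of chains of covectors\<close>

lemma invertible_iff_full_rank:
  fixes M :: "real^'m^'m"
  shows "rank M = CARD('m) \<longleftrightarrow> invertible M"
  by (metis full_rank_injective invertible_left_inverse matrix_left_invertible_injective)

lemma transpose_mult_eq_zero_imp:
  fixes M :: "real^'m^'m"
  assumes "invertible M" "\<And>r. (\<Sum>l\<in>UNIV. z l * M $ l $ r) = 0"
  shows "z l = 0"
proof -
  have "transpose M *v (\<chi> l. z l) = 0"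
    using assms(2) by (simp add: vec_eq_iff matrix_vector_mult_def transpose_def mult.commute)
  then have "(transpose (matrix_inv M) ** transpose M) *v (\<chi> l. z l) = 0"
    by (simp add: matrix_vector_mul_assoc[symmetric])
  moreover have "transpose (matrix_inv M) ** transpose M = mat 1"
    by (metis assms(1) matrix_inv_right matrix_transpose_mul transpose_mat)
  ultimately show ?thesis by (simp add: vec_eq_iff)
qed

text \<open>Here \<open>w\<^sub>l\<^sub>j\<close> is the differential of the \<open>j\<close>-th function of chain \<open>l\<close>, \<open>T\<close> is the map that
  advances along chains, and \<open>b\<^sub>r\<close> are the control vectors. The covector \<open>w\<^sub>l\<^sub>j\<close> kills \<open>T\<^sup>k b\<^sub>r\<close>
  while \<open>j + k < \<nu>\<^sub>l\<close> and gives an entry of the invertible end-of-chain matrix when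
  \<open>j + k = \<nu>\<^sub>l\<close>. Applied to \<open>T\<^sup>k b\<^sub>r\<close>, a vanishing combination thus involves only the coefficients
  at distance at most \<open>k\<close> from the chain ends, and these vanish one distance after the other.\<close>

lemma chain_covectors_independent:
  fixes w :: "'m::finite \<Rightarrow> nat \<Rightarrow> real^'n" and b :: "'m \<Rightarrow> real^'n"
  assumes step: "\<And>l j X. 1 \<le> j \<Longrightarrow> j < \<nu> l \<Longrightarrow> w l (Suc j) \<bullet> X = w l j \<bullet> T X"
    and annihilate: "\<And>l j r. 1 \<le> j \<Longrightarrow> j < \<nu> l \<Longrightarrow> w l j \<bullet> b r = 0"
    and inv: "invertible ((\<chi> l r. w l (\<nu> l) \<bullet> b r) :: real^'m^'m)"
    and sum0: "(\<Sum>(l, j)\<in>(SIGMA l:UNIV. {1..\<nu> l}). c (l, j) *\<^sub>R w l j) = 0"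
  shows "\<forall>p\<in>(SIGMA l:UNIV. {1..\<nu> l}). c p = 0"
proof -
  let ?D = "(\<chi> l r. w l (\<nu> l) \<bullet> b r) :: real^'m^'m"
  have shift: "w l j \<bullet> (T ^^ k) X = w l (j + k) \<bullet> X" if "1 \<le> j" "j + k \<le> \<nu> l" for l j k X
    using that
  proof (induction k arbitrary: X)
    case (Suc k)
    then show ?case
      using step[of "j + k" l X] by (simp add: funpow_swap1)
  qed simp
  have zero: "\<forall>l. k < \<nu> l \<longrightarrow> c (l, \<nu> l - k) = 0" for k
  proof (induction k rule: less_induct)
    case (less k)
    note IH = less.IH
    define z where "z l = (if k < \<nu> l then c (l, \<nu> l - k) else 0)" for l
    have "(\<Sum>l\<in>UNIV. z l * ?D $ l $ r) = 0" for r
    proof -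
      \<comment> \<open>Nearer to the chain end than \<open>k\<close>: known to vanish; at distance \<open>k\<close>: an entry of \<open>?D\<close>; farther away: annihilated.\<close>
      have summand: "c (l, j) * (w l j \<bullet> (T ^^ k) (b r))
          = (if j = \<nu> l - k then c (l, \<nu> l - k) * ?D $ l $ r else 0)" if j: "j \<in> {1..\<nu> l}" for l j
      proof (cases "\<nu> l - k" j rule: linorder_cases)
        case less
        then have "\<nu> l - j < k" "\<nu> l - j < \<nu> l" "\<nu> l - (\<nu> l - j) = j" using j by auto
        then have "c (l, j) = 0" using IH by metis
        then show ?thesis using less by simp
      next
        case equal
        then have "j + k = \<nu> l" using j by auto
        then show ?thesis using j equal shift[of j k l "b r"] by simp
      next
        case greater
        then show ?thesis using j shift[of j k l] annihilate[of "j + k" l r] by simp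
      qed
      have "0 = (\<Sum>(l, j)\<in>(SIGMA l:UNIV. {1..\<nu> l}). c (l, j) *\<^sub>R w l j) \<bullet> (T ^^ k) (b r)"
        using sum0 by simp
      also have "\<dots> = (\<Sum>(l, j)\<in>(SIGMA l:UNIV. {1..\<nu> l}). c (l, j) * (w l j \<bullet> (T ^^ k) (b r)))"
        by (simp add: inner_sum_left case_prod_unfold)
      also have "\<dots> = (\<Sum>l\<in>UNIV. \<Sum>j\<in>{1..\<nu> l}. c (l, j) * (w l j \<bullet> (T ^^ k) (b r)))"
        by (simp add: sum.Sigma)
      also have "\<dots> = (\<Sum>l\<in>UNIV. \<Sum>j\<in>{1..\<nu> l}. if j = \<nu> l - k then c (l, \<nu> l - k) * ?D $ l $ r else 0)"
        by (intro sum.cong refl summand)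
      also have "\<dots> = (\<Sum>l\<in>UNIV. z l * ?D $ l $ r)"
        by (intro sum.cong refl) (auto simp: z_def)
      finally show ?thesis by simp
    qed
    from transpose_mult_eq_zero_imp[OF inv this] have "z l = 0" for l .
    then show ?case by (metis z_def)
  qed
  show ?thesis
  proof
    fix p assume "p \<in> (SIGMA l:UNIV. {1..\<nu> l})"
    then obtain l j where "p = (l, j)" "1 \<le> j" "j \<le> \<nu> l" by auto
    then have "\<nu> l - j < \<nu> l" "\<nu> l - (\<nu> l - j) = j" by auto
    then show "c p = 0" using zero[of "\<nu> l - j"] \<open>p = (l, j)\<close> by metis
  qed
qed

text \<open>Extension of independent covectors to a basis, with the basis indexed by the coordinate positions;
  spanning is expressed by the fact that no nonzero vector is killed by all of them, which is
  injectivity of the resulting Jacobian.\<close>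

lemma complete_covectors:
  fixes w :: "'i \<Rightarrow> real^'n"
  assumes "finite I" and indep: "\<And>c. (\<Sum>i\<in>I. c i *\<^sub>R w i) = 0 \<Longrightarrow> \<forall>i\<in>I. c i = 0"
  obtains pos :: "'i \<Rightarrow> 'n" and B where "inj_on pos I" "\<And>i. i \<in> I \<Longrightarrow> B (pos i) = w i"
    "\<And>v. \<forall>k. B k \<bullet> v = 0 \<Longrightarrow> v = 0"
proof -
  have inj: "inj_on w I"
  proof (rule inj_onI, rule ccontr)
    fix i j assume ij: "i \<in> I" "j \<in> I" "w i = w j" "i \<noteq> j"
    have "(\<Sum>k\<in>I. (of_bool (k = i) - of_bool (k = j)) *\<^sub>R w k) = w i - w j"
      using ij assms(1)
      by (simp add: scaleR_diff_left sum_subtractf of_bool_def if_distrib[of "\<lambda>t. t *\<^sub>R _"] cong: if_cong)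
    then show False using indep[of "\<lambda>k. of_bool (k = i) - of_bool (k = j)"] ij by auto
  qed
  have "independent (w ` I)"
  proof
    assume "dependent (w ` I)"
    then obtain u where u: "\<exists>v\<in>w ` I. u v \<noteq> 0" "(\<Sum>v\<in>w ` I. u v *\<^sub>R v) = 0"
      using dependent_finite[of "w ` I"] assms(1) by auto
    then have "(\<Sum>i\<in>I. u (w i) *\<^sub>R w i) = 0" using inj by (simp add: sum.reindex)
    then show False using indep[of "\<lambda>i. u (w i)"] u(1) by auto
  qed
  then obtain E where E: "w ` I \<subseteq> E" "independent E" "UNIV \<subseteq> span E"
    by (rule maximal_independent_subset_extend[OF subset_UNIV])
  have "finite E" using E(2) by (rule finiteI_independent)
  moreover have "card E = CARD('n)"
    using basis_card_eq_dim[OF subset_UNIV E(3,2)] by simp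
  ultimately obtain B :: "'n \<Rightarrow> real^'n" where B: "bij_betw B UNIV E"
    using finite_same_card_bij[of "UNIV :: 'n set" E] by auto
  have Bw: "B (inv B (w i)) = w i" if "i \<in> I" for i
    using B E(1) that by (metis bij_betw_imp_surj_on f_inv_into_f imageI subsetD)
  show ?thesis
  proof (rule that[of "\<lambda>i. inv B (w i)" B])
    show "inj_on (\<lambda>i. inv B (w i)) I"
      using inj Bw by (metis (mono_tags, lifting) inj_on_def)
    show "v = 0" if ann: "\<forall>k. B k \<bullet> v = 0" for v
    proof -
      have "orthogonal v y" if "y \<in> E" for y
        using that B ann
        by (metis bij_betw_imp_surj_on f_inv_into_f inner_commute orthogonal_def)
      then have "orthogonal v v" using orthogonal_to_span[of v E v] E(3) by blast
      then show ?thesis by (simp add: orthogonal_self)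
    qed
  qed (rule Bw)
qed

lemma inner_sum_scaleR_matrix:
  fixes M :: "'i \<Rightarrow> real^'n^'m"
  shows "v \<bullet> ((\<Sum>i\<in>I. c i *\<^sub>R M i) *v w) = (\<Sum>i\<in>I. c i * (v \<bullet> (M i *v w)))"
  by (induction I rule: infinite_finite_induct)
     (simp_all add: matrix_vector_mult_add_rdistrib inner_add_right scaleR_matrix_vector_assoc[symmetric])

lemma inner_transpose:
  fixes A :: "real^'n^'m"
  shows "w \<bullet> (transpose A *v y) = (A *v w) \<bullet> y"
  by (metis dot_lmul_matrix inner_commute transpose_matrix_vector)

text \<open>Comparison of coefficients, by inserting \<open>v = 0\<close>, \<open>u = 0\<close> and the unit vectors.\<close>

lemma affine_quadratic_constant:
  fixes M :: "real^'n^'n" and b :: "'m::finite \<Rightarrow> real"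
  assumes "\<And>(v :: real^'n) (u :: real^'m). v \<bullet> (M *v v) + a + (\<Sum>r\<in>UNIV. u $ r * b r) = c"
  shows "a = c" and "b r = 0" and "v \<bullet> (M *v v) = 0"
proof -
  show ac: "a = c" using assms[of 0 0] by simp
  have "(\<Sum>s\<in>UNIV. axis r 1 $ s * b s) = b r"
    by (simp add: axis_def if_distrib[of "\<lambda>t. t * _"] cong: if_cong)
  then show "b r = 0" using assms[of 0 "axis r 1"] ac by simp
  show "v \<bullet> (M *v v) = 0" using assms[of v 0] ac by simp
qed

section \<open>Linearization and decoupling in a chart\<close>

lemma lie_deriv_cong_open:
  assumes "open V" "x \<in> V" "f differentiable at x" "\<And>y. y \<in> V \<Longrightarrow> f y = k y"
  shows "lie_deriv X f x = lie_deriv X k x"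
  by (simp add: lie_deriv_def partial_cong_open[OF assms])

lemma cov_deriv_differential_cong_open:
  assumes "open V" "x \<in> V" "smooth_on V f" "\<And>y. y \<in> V \<Longrightarrow> f y = k y"
  shows "cov_deriv \<Gamma> (differential f) x = cov_deriv \<Gamma> (differential k) x"
proof -
  have first: "partial j f y = partial j k y" if "y \<in> V" for j y
    using partial_cong_open[OF assms(1) that smooth_on_imp_differentiable[OF assms(3) that] assms(4)] .
  have second: "partial i (partial j f) x = partial i (partial j k) x" for i j
    by (rule partial_cong_open[OF assms(1,2) _ first])
       (rule smooth_on_imp_differentiable[OF smooth_on_partial[OF assms(3)] assms(2)])
  have eta: "(\<lambda>y. differential f y $ j) = partial j f" "(\<lambda>y. differential k y $ j) = partial j k" for j
    by (simp_all add: differential_def)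
  show ?thesis
    unfolding cov_deriv_def eta second by (simp add: differential_def first[OF assms(2)])
qed

locale mechanical_chart =
  fixes S :: "(real^'n::finite) set" and \<Gamma> :: "real^'n \<Rightarrow> real^'n^'n^'n"
    and e :: "real^'n \<Rightarrow> real^'n" and g :: "'m::finite \<Rightarrow> real^'n \<Rightarrow> real^'n"
    and h :: "real^'n \<Rightarrow> real^'m"
  assumes open_S: "open S" and smooth_\<Gamma>: "smooth_on S \<Gamma>"
    and \<Gamma>_symmetric: "\<And>x i j k. x \<in> S \<Longrightarrow> \<Gamma> x $ i $ j $ k = \<Gamma> x $ i $ k $ j"
    and smooth_e: "smooth_on S e" and smooth_g: "\<And>r. smooth_on S (g r)" and smooth_h: "smooth_on S h"
begin

abbreviation lie_out :: "'m \<Rightarrow> nat \<Rightarrow> real^'n \<Rightarrow> real"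
  where "lie_out l q \<equiv> (lie_deriv e ^^ q) (\<lambda>y. h y $ l)"

lemma smooth_lie_out: "smooth_on S (lie_out l q)"
  by (intro smooth_on_lie_deriv_funpow open_S smooth_e smooth_on_component smooth_h)

text \<open>The chain rows of the normal form are compared with the acceleration of the corresponding
  coordinate functions, for all velocities and all controls.\<close>

lemma MIOLD_solvable_imp_conditions:
  assumes "MIOLD_solvable S \<Gamma> e g h x0"
  shows "\<exists>\<nu>. vector_relative_half_degree S e g h x0 \<nu> \<and>
    covariantly_constant_differentials S \<Gamma> e h x0 \<nu>"
proof -
  obtain V \<phi> \<gamma> \<alpha> \<beta> F' h' where V: "x0 \<in> V" "V \<subseteq> S" and "diffeo_on V \<phi>"
    and adm: "admissible_feedback V \<gamma> \<alpha> \<beta>"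
    and br: "brings_into V \<phi> \<gamma> \<alpha> \<beta> (mech_system \<Gamma> e g) h F' h'" and form: "MIOLD_form (\<phi> ` V) F' h'"
    using assms unfolding MIOLD_solvable_def by blast
  from form obtain \<nu> :: "'m \<Rightarrow> nat" and idx :: "'m \<Rightarrow> nat \<Rightarrow> 'n"
    where normal_form: "(\<forall>y\<in>\<phi> ` V. \<forall>l. h' y $ l = y $ idx l 1) \<and> (\<forall>l. 1 \<le> \<nu> l) \<and>
      (\<forall>y\<in>\<phi> ` V. \<forall>w u.
        (\<forall>l j. 1 \<le> j \<and> j < \<nu> l \<longrightarrow> snd (F' (y, w) u) $ idx l j = y $ idx l (j + 1)) \<and>
        (\<forall>l. snd (F' (y, w) u) $ idx l (\<nu> l) = u $ l))"
    unfolding MIOLD_form_def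
  proof (elim exE conjE, goal_cases)
    case (1 \<nu> idx \<Gamma>' e' G')
    then show ?case by (intro 1(1)[of idx \<nu>]) blast
  qed
  have \<nu>: "1 \<le> \<nu> l" for l using normal_form by blast
  have out: "h' y $ l = y $ idx l 1" if "y \<in> \<phi> ` V" for y l using normal_form that by blast
  have chain: "snd (F' (y, w) u) $ idx l j = y $ idx l (j + 1)"
    if "y \<in> \<phi> ` V" "1 \<le> j" "j < \<nu> l" for y w u l j using normal_form that by blast
  have last: "snd (F' (y, w) u) $ idx l (\<nu> l) = u $ l" if "y \<in> \<phi> ` V" for y w u l
    using normal_form that by blast
  have oV: "open V" and sm\<phi>: "smooth_on V \<phi>" using \<open>diffeo_on V \<phi>\<close> by (auto simp: diffeo_on_def)
  define \<psi> where "\<psi> l j x = \<phi> x $ idx l j" for l j x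
  have sm\<psi>: "smooth_on V (\<psi> l j)" for l j
    unfolding \<psi>_def by (rule smooth_on_component[OF oV sm\<phi>])
  have acc: "snd (F' (\<phi> x, frechet_derivative \<phi> (at x) v) u') $ idx l j
      = v \<bullet> (cov_deriv \<Gamma> (differential (\<psi> l j)) x *v v) + lie_deriv e (\<psi> l j) x
        + (\<Sum>r\<in>UNIV. mech_feedback \<gamma> \<alpha> \<beta> (x, v) u' $ r * lie_deriv (g r) (\<psi> l j) x)"
    if "x \<in> V" for x v u' l j
  proof -
    have "F' (\<phi> x, frechet_derivative \<phi> (at x) v) u'
      = frechet_derivative (mech_diffeo \<phi>) (at (x, v)) (mech_system \<Gamma> e g (x, v) (mech_feedback \<gamma> \<alpha> \<beta> (x, v) u'))"
      using br that unfolding brings_into_def by (simp add: mech_diffeo_def)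
    then show ?thesis
      using mech_diffeo_system_velocity_acceleration(2)[OF oV that sm\<phi>] by (simp add: \<psi>_def[abs_def])
  qed
  have any_control: "\<exists>u'. mech_feedback \<gamma> \<alpha> \<beta> (x, v) u' = u" if "x \<in> V" for x v u
  proof
    have "invertible (\<beta> x)" using adm that by (simp add: admissible_feedback_def)
    then show "mech_feedback \<gamma> \<alpha> \<beta> (x, v) (matrix_inv (\<beta> x) *v (u - bilin (\<gamma> x) v v - \<alpha> x)) = u"
      by (simp add: mech_feedback_def matrix_vector_mul_assoc matrix_inv_right)
  qed
  have step: "lie_deriv e (\<psi> l j) x = \<psi> l (Suc j) x" "lie_deriv (g r) (\<psi> l j) x = 0"
    "cov_deriv \<Gamma> (differential (\<psi> l j)) x = 0"
    if x: "x \<in> V" and j: "1 \<le> j" "j < \<nu> l" for x l j r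
  proof -
    have eq: "v \<bullet> (cov_deriv \<Gamma> (differential (\<psi> l j)) x *v v) + lie_deriv e (\<psi> l j) x
        + (\<Sum>r\<in>UNIV. u $ r * lie_deriv (g r) (\<psi> l j) x) = \<psi> l (Suc j) x" for v and u :: "real^'m"
    proof -
      obtain u' where "mech_feedback \<gamma> \<alpha> \<beta> (x, v) u' = u" using any_control[OF x] by blast
      then show ?thesis
        using acc[OF x, of v u' l j] chain[OF imageI[OF x] j] by (simp add: \<psi>_def)
    qed
    \<comment> \<open>The right-hand side depends on the configuration only, while \<open>v\<close> and \<open>u\<close> are arbitrary.\<close>
    note coeffs = affine_quadratic_constant[OF eq]
    show "lie_deriv e (\<psi> l j) x = \<psi> l (Suc j) x" "lie_deriv (g r) (\<psi> l j) x = 0"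
      by (fact coeffs)+
    show "cov_deriv \<Gamma> (differential (\<psi> l j)) x = 0"
    proof (rule symmetric_quadratic_form_zero[OF _ coeffs(3)])
      show "cov_deriv \<Gamma> (differential (\<psi> l j)) x $ i $ k = cov_deriv \<Gamma> (differential (\<psi> l j)) x $ k $ i" for i k
        by (rule cov_deriv_differential_symmetric[OF oV x sm\<psi> \<Gamma>_symmetric]) (use x V in auto)
    qed
  qed
  have \<psi>_eq: "\<psi> l (Suc q) x = lie_out l q x" if "x \<in> V" "q < \<nu> l" for x l q
    using that
  proof (induction q arbitrary: x)
    case 0
    then show ?case
      using out[of "\<phi> x" l] br by (simp add: \<psi>_def brings_into_def)
  next
    case (Suc q)
    have "\<psi> l (Suc (Suc q)) x = lie_deriv e (\<psi> l (Suc q)) x"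
      using step(1)[of x "Suc q" l] Suc.prems by simp
    also have "\<dots> = lie_deriv e (lie_out l q) x"
      by (rule lie_deriv_cong_open[OF oV Suc.prems(1)])
         (use Suc.IH Suc.prems smooth_on_imp_differentiable[OF sm\<psi>] in auto)
    finally show ?case by simp
  qed
  have lie_eq: "lie_deriv X (lie_out l q) x = lie_deriv X (\<psi> l (Suc q)) x" if "x \<in> V" "q < \<nu> l" for X l q x
    by (rule lie_deriv_cong_open[OF oV that(1), symmetric])
       (use \<psi>_eq that smooth_on_imp_differentiable[OF sm\<psi>] in auto)
  have cov_eq: "cov_deriv \<Gamma> (differential (lie_out l q)) x = cov_deriv \<Gamma> (differential (\<psi> l (Suc q))) x"
    if "x \<in> V" "q < \<nu> l" for l q x
    by (rule cov_deriv_differential_cong_open[OF oV that(1) sm\<psi>, symmetric]) (use \<psi>_eq that in auto)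
  let ?D = "decoupling_matrix e g h \<nu> x0"
  have D: "?D $ l $ r = lie_deriv (g r) (\<psi> l (\<nu> l)) x0" for l r
    using lie_eq[OF V(1), of "\<nu> l - 1" l "g r"] \<nu>[of l] by (simp add: decoupling_matrix_def)
  \<comment> \<open>At zero velocity the quadratic terms of the dynamics and of the feedback disappear.\<close>
  have lin: "lie_deriv e (\<psi> l (\<nu> l)) x0 + (?D *v (\<alpha> x0 + \<beta> x0 *v u')) $ l = u' $ l" for u' l
    using acc[OF V(1), of 0 u' l "\<nu> l"] last[OF imageI[OF V(1)]]
    by (simp add: mech_feedback_def bilin_def matrix_vector_mult_def[of ?D] D mult.commute
        linear_0 zero_vec_def[symmetric])
  \<comment> \<open>The difference of the previous equations for \<open>u'\<close> and \<open>0\<close>.\<close>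
  have "?D *v (\<beta> x0 *v u') = u'" for u'
    using lin[of _ u'] lin[of _ 0] by (simp add: vec_eq_iff matrix_vector_right_distrib)
      (metis add.assoc add_diff_cancel_left' diff_zero)
  then have "?D ** \<beta> x0 = mat 1"
    by (simp add: matrix_eq matrix_vector_mul_assoc[symmetric])
  then have "rank ?D = CARD('m)"
    by (metis invertible_iff_full_rank invertible_right_inverse)
  moreover have "lie_deriv (g r) (lie_out l q) x = 0" if "x \<in> V" "q + 2 \<le> \<nu> l" for x l q r
    using lie_eq[OF that(1)] step(2)[OF that(1), of "Suc q" l r] that(2) by simp
  moreover have "cov_deriv \<Gamma> (differential (lie_out l q)) x = 0" if "x \<in> V" "q + 2 \<le> \<nu> l" for x l q
    using cov_eq[OF that(1)] step(3)[OF that(1), of "Suc q" l] that(2) by simp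
  ultimately show ?thesis
    unfolding vector_relative_half_degree_def covariantly_constant_differentials_def
    using \<nu> oV V by (intro exI[of _ \<nu>] conjI exI[of _ V] allI ballI impI) auto
qed

text \<open>The independence argument is applied with \<open>T X = \<nabla>\<^sub>X e\<close> and the vectors \<open>g\<^sub>r\<close> at the base point;
  the positions outside the chains are filled with linear functions.\<close>

lemma adapted_coordinates:
  assumes "open N" "x0 \<in> N" "N \<subseteq> S"
    and zero: "\<And>x l r q. x \<in> N \<Longrightarrow> q + 2 \<le> \<nu> l \<Longrightarrow> lie_deriv (g r) (lie_out l q) x = 0"
    and cov: "\<And>x l q. x \<in> N \<Longrightarrow> q + 2 \<le> \<nu> l \<Longrightarrow> cov_deriv \<Gamma> (differential (lie_out l q)) x = 0"
    and inv: "invertible (decoupling_matrix e g h \<nu> x0)"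
  obtains V \<phi> and idx :: "'m \<Rightarrow> nat \<Rightarrow> 'n" where "x0 \<in> V" "V \<subseteq> N" "diffeo_on V \<phi>"
    "\<And>x. x \<in> V \<Longrightarrow> invertible (matrix (frechet_derivative \<phi> (at x)))"
    "inj_on (\<lambda>(l, j). idx l j) (SIGMA l:UNIV. {1..\<nu> l})"
    "\<And>l j x. 1 \<le> j \<Longrightarrow> j \<le> \<nu> l \<Longrightarrow> \<phi> x $ idx l j = lie_out l (j - 1) x"
proof -
  let ?I = "SIGMA l:(UNIV :: 'm set). {1..\<nu> l}"
  have x0: "x0 \<in> S" using assms by auto
  define w where "w l j = differential (lie_out l (j - 1)) x0" for l j
  define T where "T X = frechet_derivative e (at x0) X + bilin (\<Gamma> x0) (e x0) X" for X
  have w_step: "w l (Suc j) \<bullet> X = w l j \<bullet> T X" if "1 \<le> j" "j < \<nu> l" for l j X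
  proof -
    have "w l (Suc j) = differential (lie_deriv e (lie_out l (j - 1))) x0"
      using that by (cases j) (simp_all add: w_def)
    then show ?thesis
      using inner_differential_lie_deriv[OF open_S x0 smooth_lie_out[where l = l and q = "j - 1"] smooth_e, of X \<Gamma>]
        cov[OF assms(2), of "j - 1" l] that
      by (simp add: w_def T_def)
  qed
  have w_zero: "w l j \<bullet> g r x0 = 0" if "1 \<le> j" "j < \<nu> l" for l j r
    using zero[OF assms(2), of "j - 1" l r] that by (simp add: w_def lie_deriv_eq_inner)
  have w_inv: "invertible ((\<chi> l r. w l (\<nu> l) \<bullet> g r x0) :: real^'m^'m)"
    using inv by (simp add: decoupling_matrix_def w_def lie_deriv_eq_inner)
  have indep: "\<forall>p\<in>?I. c p = 0" if "(\<Sum>p\<in>?I. c p *\<^sub>R (case p of (l, j) \<Rightarrow> w l j)) = 0" for c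
    using chain_covectors_independent[of \<nu> w T "\<lambda>r. g r x0" c, OF w_step w_zero w_inv] that
    by (simp add: case_prod_unfold)
  have fin: "finite ?I" by (intro finite_SigmaI) auto
  have "\<exists>(pos :: 'm \<times> nat \<Rightarrow> 'n) B. inj_on pos ?I \<and> (\<forall>p\<in>?I. B (pos p) = (case p of (l, j) \<Rightarrow> w l j)) \<and>
      (\<forall>v. (\<forall>k. B k \<bullet> v = 0) \<longrightarrow> v = 0)"
    by (rule complete_covectors[of ?I "\<lambda>p. case p of (l, j) \<Rightarrow> w l j", OF fin])
       (rule indep, assumption, blast)
  then obtain pos :: "'m \<times> nat \<Rightarrow> 'n" and B where pos: "inj_on pos ?I"
    and B: "\<And>p. p \<in> ?I \<Longrightarrow> B (pos p) = (case p of (l, j) \<Rightarrow> w l j)"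
    and span: "\<And>v. \<forall>k. B k \<bullet> v = 0 \<Longrightarrow> v = 0"
    by blast
  define \<phi> :: "real^'n \<Rightarrow> real^'n" where "\<phi> x = (\<chi> k. if k \<in> pos ` ?I
    then (case inv_into ?I pos k of (l, j) \<Rightarrow> lie_out l (j - 1) x) else B k \<bullet> x)" for x
  have \<phi>_chain: "\<phi> x $ pos (l, j) = lie_out l (j - 1) x" if "1 \<le> j" "j \<le> \<nu> l" for l j x
    using that pos by (auto simp: \<phi>_def)
  have comp: "smooth_on S (\<lambda>x. \<phi> x $ k) \<and> differential (\<lambda>x. \<phi> x $ k) x0 = B k" for k
  proof (cases "k \<in> pos ` ?I")
    case True
    then obtain l j where k: "k = pos (l, j)" "1 \<le> j" "j \<le> \<nu> l" by auto
    then have "(\<lambda>x. \<phi> x $ k) = lie_out l (j - 1)" using \<phi>_chain by auto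
    then show ?thesis using smooth_lie_out k B[of "(l, j)"] by (simp add: w_def)
  next
    case False
    have bl: "bounded_linear (\<lambda>x. B k \<bullet> x)" by (rule bounded_linear_inner_right)
    have "(\<lambda>x. \<phi> x $ k) = (\<lambda>x. B k \<bullet> x)" using False by (auto simp: \<phi>_def)
    moreover have "frechet_derivative (\<lambda>x. B k \<bullet> x) (at x0) = (\<lambda>x. B k \<bullet> x)"
      by (rule frechet_derivative_at[symmetric]) (rule bounded_linear_imp_has_derivative[OF bl])
    ultimately show ?thesis
      using smooth_on_linear[OF bl open_S smooth_on_ident[OF open_S]]
      by (simp add: differential_def partial_def vec_eq_iff inner_axis)
  qed
  have sm\<phi>: "smooth_on S \<phi>" using comp by (intro smooth_on_vecI[OF open_S]) auto
  have inj: "inj (frechet_derivative \<phi> (at x0))"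
  proof -
    have lin: "linear (frechet_derivative \<phi> (at x0))"
      using smooth_on_has_derivative[OF sm\<phi> x0] has_derivative_linear by blast
    have "v = 0" if v: "frechet_derivative \<phi> (at x0) v = 0" for v
    proof (rule span, rule allI)
      fix k
      have "0 = frechet_derivative \<phi> (at x0) v $ k" using v by simp
      also have "\<dots> = differential (\<lambda>x. \<phi> x $ k) x0 \<bullet> v"
        using frechet_derivative_component[OF smooth_on_imp_differentiable[OF sm\<phi> x0]]
          frechet_derivative_eq_differential smooth_on_imp_differentiable comp x0 by metis
      finally show "B k \<bullet> v = 0" using comp by simp
    qed
    then show ?thesis using linear_injective_0[OF lin] by blast
  qed
  obtain V where "x0 \<in> V" "V \<subseteq> N" "diffeo_on V \<phi>"
    "\<And>x. x \<in> V \<Longrightarrow> invertible (matrix (frechet_derivative \<phi> (at x)))"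
    using local_diffeomorphism[OF assms(1,2) smooth_on_subset[OF sm\<phi> assms(3)] inj] by blast
  then show ?thesis
    using that[of V \<phi> "\<lambda>l j. pos (l, j)"] pos \<phi>_chain by simp
qed


text \<open>In adapted coordinates the chain rows hold already without feedback, because their
  accelerations involve neither velocities nor controls. At the chain ends the
  accelerations are \<open>p\<^sub>l(x,v) + (D(x) u)\<^sub>l\<close> with \<open>p\<^sub>l = (\<nabla>dL\<^sub>e\<^bsup>\<nu>-1\<^esup>h\<^sub>l)(v,v) + L\<^sub>e\<^bsup>\<nu>\<^esup>h\<^sub>l\<close>, so the feedback
  is \<open>u = D\<^sup>-\<^sup>1(u' - p)\<close> for the new control \<open>u'\<close>. The remaining rows are whatever the pushed-forward closed loop has there.\<close>

lemma conditions_imp_MIOLD_solvable: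
  assumes "vector_relative_half_degree S e g h x0 \<nu>"
    and "covariantly_constant_differentials S \<Gamma> e h x0 \<nu>"
  shows "MIOLD_solvable S \<Gamma> e g h x0"
proof -
  let ?I = "SIGMA l:(UNIV :: 'm set). {1..\<nu> l}"
  obtain N1 where N1: "open N1" "x0 \<in> N1" "N1 \<subseteq> S"
    "\<And>x l r q. x \<in> N1 \<Longrightarrow> q + 2 \<le> \<nu> l \<Longrightarrow> lie_deriv (g r) (lie_out l q) x = 0"
    using assms(1) unfolding vector_relative_half_degree_def by blast
  obtain N2 where N2: "open N2" "x0 \<in> N2"
    "\<And>x l q. x \<in> N2 \<Longrightarrow> q + 2 \<le> \<nu> l \<Longrightarrow> cov_deriv \<Gamma> (differential (lie_out l q)) x = 0"
    using assms(2) unfolding covariantly_constant_differentials_def by blast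
  have \<nu>: "1 \<le> \<nu> l" for l using assms(1) by (simp add: vector_relative_half_degree_def)
  let ?D = "decoupling_matrix e g h \<nu>"
  have D_inv: "invertible (?D x0)"
    using assms(1) invertible_iff_full_rank by (auto simp: vector_relative_half_degree_def)
  have smD: "smooth_on S ?D"
    unfolding decoupling_matrix_def
    by (intro smooth_on_vecI[OF open_S]) (simp add: smooth_on_lie_deriv open_S smooth_g smooth_lie_out)
  \<comment> \<open>The decoupling matrix is invertible at \<open>x0\<close>, but the feedback needs its inverse on a neighborhood.\<close>
  define N where "N = {x \<in> N1 \<inter> N2. det (?D x) \<noteq> 0}"
  have N: "open N"
  proof -
    have "continuous_on (N1 \<inter> N2) (\<lambda>x. det (?D x))"
      using smooth_on_imp_continuous_on[OF smooth_on_det[OF open_S smD]] N1(3) continuous_on_subset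
      by blast
    moreover have "N = (N1 \<inter> N2) \<inter> (\<lambda>x. det (?D x)) -` (- {0})" by (auto simp: N_def)
    ultimately show ?thesis
      using continuous_open_preimage[of "N1 \<inter> N2" "\<lambda>x. det (?D x)" "- {0}"] N1(1) N2(1) by auto
  qed
  have x0: "x0 \<in> N" using N1 N2 D_inv by (auto simp: N_def invertible_det_nz)
  obtain V \<phi> and idx :: "'m \<Rightarrow> nat \<Rightarrow> 'n" where V: "x0 \<in> V" "V \<subseteq> N" "diffeo_on V \<phi>"
    and jac: "\<And>x. x \<in> V \<Longrightarrow> invertible (matrix (frechet_derivative \<phi> (at x)))"
    and inj: "inj_on (\<lambda>(l, j). idx l j) ?I"
    and chain: "\<And>l j x. 1 \<le> j \<Longrightarrow> j \<le> \<nu> l \<Longrightarrow> \<phi> x $ idx l j = lie_out l (j - 1) x"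
    by (rule adapted_coordinates[of N x0 \<nu>]) (use N x0 N1 N2 D_inv in \<open>auto simp: N_def\<close>)
  have VS: "V \<subseteq> S" and oV: "open V" and oW: "open (\<phi> ` V)" and inj\<phi>: "inj_on \<phi> V"
    and sm\<phi>: "smooth_on V \<phi>" and sm\<theta>: "smooth_on (\<phi> ` V) (inv_into V \<phi>)"
    using V N1(3) by (auto simp: diffeo_on_def N_def)
  have inv: "invertible (?D x)" if "x \<in> V" for x
    using that V by (auto simp: N_def invertible_det_nz)
  note restrict = smooth_on_subset[OF _ VS]
  define C where "C i = cov_deriv \<Gamma> (differential (\<lambda>y. \<phi> y $ i))" for i
  define C' where "C' l = cov_deriv \<Gamma> (differential (lie_out l (\<nu> l - 1)))" for l
  \<comment> \<open>The feedback solves the equations at the chain ends; its quadratic part cancels \<open>C'\<close>, whose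
    symmetry it inherits.\<close>
  define \<beta> where "\<beta> x = matrix_inv (?D x)" for x
  define \<alpha> where "\<alpha> x = - (\<beta> x *v (\<chi> l. lie_out l (\<nu> l) x))" for x
  define \<gamma> :: "real^'n \<Rightarrow> real^'n^'n^'m" where "\<gamma> x = (\<chi> r. - (\<Sum>l\<in>UNIV. \<beta> x $ r $ l *\<^sub>R C' l x))" for x
  have smC: "smooth_on V (C i)" for i
    unfolding C_def
    by (intro smooth_on_cov_deriv_differential oV restrict[OF smooth_\<Gamma>] smooth_on_component sm\<phi>)
  have smC': "smooth_on V (C' l)" for l
    unfolding C'_def
    by (intro smooth_on_cov_deriv_differential oV restrict[OF smooth_\<Gamma>] restrict[OF smooth_lie_out])
  have sm\<beta>: "smooth_on V \<beta>"
    unfolding \<beta>_def by (intro smooth_on_matrix_inv oV restrict[OF smD] inv)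
  have sm\<alpha>: "smooth_on V \<alpha>"
  proof -
    have "smooth_on V (\<lambda>x. (\<chi> l. lie_out l (\<nu> l) x) :: real^'m)"
      by (rule smooth_on_vecI[OF oV]) (use restrict[OF smooth_lie_out] in simp)
    then show ?thesis
      unfolding \<alpha>_def by (intro smooth_on_minus smooth_on_matrix_vector_mult oV sm\<beta>)
  qed
  have sm\<gamma>: "smooth_on V \<gamma>"
  proof (rule smooth_on_vecI[OF oV])
    fix r
    have "smooth_on V (\<lambda>x. - (\<Sum>l\<in>UNIV. \<beta> x $ r $ l *\<^sub>R C' l x))"
      by (intro smooth_on_minus[OF oV] smooth_on_sum[OF oV] smooth_on_bilinear[OF bounded_bilinear_scaleR oV]
          smooth_on_component[OF oV] sm\<beta> smC')
    then show "smooth_on V (\<lambda>x. \<gamma> x $ r)" by (simp add: \<gamma>_def)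
  qed
  have C'_sym: "C' l x $ j $ k = C' l x $ k $ j" if "x \<in> V" for l x j k
    unfolding C'_def
    by (rule cov_deriv_differential_symmetric[OF open_S _ smooth_lie_out \<Gamma>_symmetric]) (use that VS in auto)
  have adm: "admissible_feedback V \<gamma> \<alpha> \<beta>"
    unfolding admissible_feedback_def
  proof (intro conjI ballI allI sm\<gamma> sm\<alpha> sm\<beta>)
    show "\<gamma> x $ r $ j $ k = \<gamma> x $ r $ k $ j" if "x \<in> V" for x r j k
      using C'_sym[OF that] by (simp add: \<gamma>_def)
    show "invertible (\<beta> x)" if "x \<in> V" for x
      using matrix_inv_left[OF inv[OF that]] matrix_inv_right[OF inv[OF that]]
      unfolding \<beta>_def invertible_def by blast
  qed
  \<comment> \<open>The inverse Jacobian recovers the old velocity from the new one.\<close>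
  define \<eta> where "\<eta> x = matrix_inv (matrix (frechet_derivative \<phi> (at x)))" for x
  have sm\<eta>: "smooth_on V \<eta>"
    unfolding \<eta>_def by (intro smooth_on_matrix_inv smooth_on_jacobian oV sm\<phi> jac)
  have \<eta>: "\<eta> x *v frechet_derivative \<phi> (at x) v = v" "frechet_derivative \<phi> (at x) (\<eta> x *v v) = v"
    if "x \<in> V" for x v
  proof -
    have "linear (frechet_derivative \<phi> (at x))"
      using smooth_on_has_derivative[OF sm\<phi> that] has_derivative_linear by blast
    then have "frechet_derivative \<phi> (at x) w = matrix (frechet_derivative \<phi> (at x)) *v w" for w
      by (simp add: matrix_works)
    then show "\<eta> x *v frechet_derivative \<phi> (at x) v = v" "frechet_derivative \<phi> (at x) (\<eta> x *v v) = v"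
      using jac[OF that] by (simp_all add: \<eta>_def matrix_vector_mul_assoc matrix_inv_left matrix_inv_right)
  qed
  define Z where "Z x v u' = frechet_derivative (mech_diffeo \<phi>) (at (x, v))
      (mech_system \<Gamma> e g (x, v) (mech_feedback \<gamma> \<alpha> \<beta> (x, v) u'))" for x v u'
  define b where "b i x = (\<chi> r. lie_deriv (g r) (\<lambda>y. \<phi> y $ i) x)" for i x
  have smb: "smooth_on V (b i)" for i
    by (rule smooth_on_vecI[OF oV])
       (simp add: b_def smooth_on_lie_deriv smooth_on_component oV sm\<phi> restrict[OF smooth_g])
  have acc: "snd (Z x v u') $ i = v \<bullet> (C i x *v v) + lie_deriv e (\<lambda>y. \<phi> y $ i) x
      + mech_feedback \<gamma> \<alpha> \<beta> (x, v) u' \<bullet> b i x" if "x \<in> V" for x v u' i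
    using mech_diffeo_system_velocity_acceleration(2)[OF oV that sm\<phi>, of v \<Gamma> e g]
    by (simp add: Z_def C_def b_def inner_vec_def)
  have vel: "fst (Z x v u') = frechet_derivative \<phi> (at x) v" if "x \<in> V" for x v u'
    unfolding Z_def by (rule mech_diffeo_system_velocity_acceleration(1)[OF oV that sm\<phi>])
  \<comment> \<open>Coefficients of the closed-loop acceleration: the feedback adds its own quadratic part to that of the
    drift, and \<open>M\<close> expresses the sum in the new velocities, with the sign of a Christoffel term.\<close>
  define K where "K i x = C i x + (\<Sum>r\<in>UNIV. b i x $ r *\<^sub>R \<gamma> x $ r)" for i x
  define M where "M x = (\<chi> i. - (transpose (\<eta> x) ** K i x ** \<eta> x))" for x
  define E where "E x = (\<chi> i. lie_deriv e (\<lambda>y. \<phi> y $ i) x + \<alpha> x \<bullet> b i x)" for x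
  define G where "G x = (\<chi> i. transpose (\<beta> x) *v b i x)" for x
  have acc': "snd (Z x (\<eta> x *v w) u') = - bilin (M x) w w + E x + G x *v u'" if "x \<in> V" for x w u'
  proof -
    have "snd (Z x (\<eta> x *v w) u') $ i = (- bilin (M x) w w + E x + G x *v u') $ i" for i
    proof -
      let ?v = "\<eta> x *v w"
      have "bilin (\<gamma> x) ?v ?v \<bullet> b i x = ?v \<bullet> ((\<Sum>r\<in>UNIV. b i x $ r *\<^sub>R \<gamma> x $ r) *v ?v)"
        by (simp add: inner_sum_scaleR_matrix bilin_def inner_vec_def[of "vec_lambda _"] mult.commute)
      then have "?v \<bullet> (C i x *v ?v) + bilin (\<gamma> x) ?v ?v \<bullet> b i x = ?v \<bullet> (K i x *v ?v)"
        by (simp add: K_def matrix_vector_mult_add_rdistrib inner_add_right)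
      also have "\<dots> = w \<bullet> ((transpose (\<eta> x) ** K i x ** \<eta> x) *v w)"
        by (simp add: matrix_vector_mul_assoc[symmetric] inner_transpose del: transpose_matrix_vector)
      also have "\<dots> = - bilin (M x) w w $ i"
        using matrix_vector_mult_diff_rdistrib[of 0 "transpose (\<eta> x) ** K i x ** \<eta> x" w]
        by (simp add: bilin_def M_def)
      finally have quad: "?v \<bullet> (C i x *v ?v) + bilin (\<gamma> x) ?v ?v \<bullet> b i x = - bilin (M x) w w $ i" .
      have "(\<beta> x *v u') \<bullet> b i x = (G x *v u') $ i"
        by (simp add: G_def matrix_vector_mul_component inner_commute[of _ u'] inner_transpose
            del: transpose_matrix_vector)
      then show ?thesis
        using quad by (simp add: acc[OF that] mech_feedback_def E_def inner_add_left)
    qed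
    then show ?thesis by (simp add: vec_eq_iff)
  qed
  have smM: "smooth_on V M"
  proof (rule smooth_on_vecI[OF oV])
    fix i
    have "smooth_on V (\<lambda>x. transpose (\<eta> x))"
      by (intro smooth_on_vecI[OF oV]) (simp add: transpose_def smooth_on_component oV sm\<eta>)
    moreover have "smooth_on V (K i)"
      unfolding K_def
      by (intro smooth_on_add[OF oV] smC smooth_on_sum[OF oV] smooth_on_bilinear[OF bounded_bilinear_scaleR oV]
          smooth_on_component[OF oV] smb sm\<gamma>)
    ultimately have "smooth_on V (\<lambda>x. - (transpose (\<eta> x) ** K i x ** \<eta> x))"
      by (intro smooth_on_minus[OF oV] smooth_on_matrix_mult[OF oV] sm\<eta>)
    then show "smooth_on V (\<lambda>x. M x $ i)" by (simp add: M_def)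
  qed
  have smE: "smooth_on V E"
  proof (rule smooth_on_vecI[OF oV])
    fix i
    have "smooth_on V (\<lambda>x. lie_deriv e (\<lambda>y. \<phi> y $ i) x + \<alpha> x \<bullet> b i x)"
      by (intro smooth_on_add[OF oV] smooth_on_lie_deriv[OF oV] restrict[OF smooth_e] smooth_on_component[OF oV]
          sm\<phi> smooth_on_bilinear[OF bounded_bilinear_inner oV] sm\<alpha> smb)
    then show "smooth_on V (\<lambda>x. E x $ i)" by (simp add: E_def)
  qed
  have smG: "smooth_on V G"
  proof (rule smooth_on_vecI[OF oV])
    fix i
    have "smooth_on V (\<lambda>x. transpose (\<beta> x))"
      by (intro smooth_on_vecI[OF oV]) (simp add: transpose_def smooth_on_component oV sm\<beta>)
    then have "smooth_on V (\<lambda>x. transpose (\<beta> x) *v b i x)"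
      by (intro smooth_on_matrix_vector_mult oV smb)
    then show "smooth_on V (\<lambda>x. G x $ i)" by (simp add: G_def)
  qed
  have row: "snd (Z x v u') $ idx l j = \<phi> x $ idx l (j + 1)"
    if x: "x \<in> V" and j: "1 \<le> j" "j < \<nu> l" for x v u' l j
  proof -
    have q: "j - 1 + 2 \<le> \<nu> l" using j by simp
    have f: "(\<lambda>y. \<phi> y $ idx l j) = lie_out l (j - 1)" using chain j by auto
    have "C (idx l j) x = 0" "b (idx l j) x = 0"
      using N2(3)[OF _ q] N1(4)[OF _ q] x V(2) by (auto simp: C_def b_def f N_def vec_eq_iff)
    moreover have "lie_deriv e (lie_out l (j - 1)) x = \<phi> x $ idx l (j + 1)"
      using chain[of "j + 1" l x] j by (cases j) auto
    ultimately show ?thesis by (simp add: acc[OF x] f)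
  qed
  have last: "snd (Z x v u') $ idx l (\<nu> l) = u' $ l" if x: "x \<in> V" for x v u' l
  proof -
    define p where "p = (\<chi> l. v \<bullet> (C' l x *v v) + lie_out l (\<nu> l) x)"
    have "bilin (\<gamma> x) v v $ r = - (\<beta> x *v (\<chi> l. v \<bullet> (C' l x *v v))) $ r" for r
    proof -
      have "bilin (\<gamma> x) v v $ r = v \<bullet> ((\<Sum>l\<in>UNIV. (- \<beta> x $ r $ l) *\<^sub>R C' l x) *v v)"
        by (simp add: bilin_def \<gamma>_def sum_negf)
      then show ?thesis
        unfolding inner_sum_scaleR_matrix by (simp add: matrix_vector_mult_def[of "\<beta> x"] sum_negf)
    qed
    then have "bilin (\<gamma> x) v v = - (\<beta> x *v (\<chi> l. v \<bullet> (C' l x *v v)))" by (simp add: vec_eq_iff)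
    moreover have "p = (\<chi> l. v \<bullet> (C' l x *v v)) + (\<chi> l. lie_out l (\<nu> l) x)" by (simp add: p_def vec_eq_iff)
    ultimately have "mech_feedback \<gamma> \<alpha> \<beta> (x, v) u' = \<beta> x *v (u' - p)"
      by (simp add: mech_feedback_def \<alpha>_def matrix_vector_mult_diff_distrib matrix_vector_right_distrib)
    then have "?D x *v mech_feedback \<gamma> \<alpha> \<beta> (x, v) u' = u' - p"
      by (simp add: matrix_vector_mul_assoc \<beta>_def matrix_inv_right inv[OF x])
    moreover have f: "(\<lambda>y. \<phi> y $ idx l (\<nu> l)) = lie_out l (\<nu> l - 1)" using chain \<nu> by auto
    moreover have "mech_feedback \<gamma> \<alpha> \<beta> (x, v) u' \<bullet> b (idx l (\<nu> l)) x = (?D x *v mech_feedback \<gamma> \<alpha> \<beta> (x, v) u') $ l"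
      by (simp add: b_def f decoupling_matrix_def matrix_vector_mult_def inner_vec_def mult.commute)
    moreover have "lie_deriv e (lie_out l (\<nu> l - 1)) x = lie_out l (\<nu> l) x"
      using \<nu>[of l] by (cases "\<nu> l") auto
    ultimately show ?thesis by (simp add: acc[OF x] C_def C'_def p_def)
  qed
  define \<theta> where "\<theta> = inv_into V \<phi>"
  have \<theta>: "\<theta> (\<phi> x) = x" if "x \<in> V" for x using inj\<phi> that by (simp add: \<theta>_def)
  define F' where "F' = (\<lambda>(y, w) u'. Z (\<theta> y) (\<eta> (\<theta> y) *v w) u')"
  have "brings_into V \<phi> \<gamma> \<alpha> \<beta> (mech_system \<Gamma> e g) h F' (\<lambda>y. h (\<theta> y))"
    unfolding brings_into_def by (simp add: F'_def mech_diffeo_def \<theta> \<eta> Z_def)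
  moreover have "MIOLD_form (\<phi> ` V) F' (\<lambda>y. h (\<theta> y))"
    unfolding MIOLD_form_def
  proof (intro exI[of _ \<nu>] exI[of _ idx] exI[of _ "\<lambda>y. M (\<theta> y)"] exI[of _ "\<lambda>y. E (\<theta> y)"]
      exI[of _ "\<lambda>y. G (\<theta> y)"] conjI allI \<nu> inj)
    have *: "inv_into V \<phi> ` \<phi> ` V \<subseteq> V" by (auto intro: inv_into_into)
    show "smooth_on (\<phi> ` V) (\<lambda>y. M (\<theta> y))" "smooth_on (\<phi> ` V) (\<lambda>y. E (\<theta> y))" "smooth_on (\<phi> ` V) (\<lambda>y. G (\<theta> y))"
      unfolding \<theta>_def
      using smooth_on_compose[OF oW * sm\<theta>] smM smE smG by blast+
    show "\<forall>y\<in>\<phi> ` V. \<forall>l. h (\<theta> y) $ l = y $ idx l 1"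
      using chain \<nu> by (auto simp: \<theta>)
    show "\<forall>y\<in>\<phi> ` V. \<forall>w u. fst (F' (y, w) u) = w \<and>
        (\<forall>l j. 1 \<le> j \<and> j < \<nu> l \<longrightarrow> snd (F' (y, w) u) $ idx l j = y $ idx l (j + 1)) \<and>
        (\<forall>l. snd (F' (y, w) u) $ idx l (\<nu> l) = u $ l) \<and>
        (\<forall>i. i \<notin> (\<lambda>(l, j). idx l j) ` ?I \<longrightarrow>
          snd (F' (y, w) u) $ i = (- bilin (M (\<theta> y)) w w + E (\<theta> y) + G (\<theta> y) *v u) $ i)"
      by (auto simp: F'_def \<theta> vel \<eta> row last) (simp add: acc')
  qed
  ultimately show ?thesis
    unfolding MIOLD_solvable_def using V(1,3) VS adm by blast
qed

end

section \<open>Linearization and decoupling on a manifold\<close>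

theorem theorem1:
  fixes Q :: "'q topology"
    and A :: "('q, 'n::finite) chart set"
    and \<Gamma> :: "('q, 'n) chart \<Rightarrow> real^'n \<Rightarrow> real^'n^'n^'n"
    and e :: "('q, 'n) chart \<Rightarrow> real^'n \<Rightarrow> real^'n"
    and g :: "'m::finite \<Rightarrow> ('q, 'n) chart \<Rightarrow> real^'n \<Rightarrow> real^'n"
    and h :: "'q \<Rightarrow> real^'m"
    and C :: "('q, 'n) chart"
    and x0 :: 'q
  assumes "smooth_manifold Q A"
    and "symmetric_affine_connection A \<Gamma>"
    and "vector_field A e"
    and "\<And>r. vector_field A (g r)"
    and "smooth_map_on_manifold A h"
    and "C \<in> A" and "x0 \<in> dom_of C"
  shows "MIOLD_solvable (coord_range C) (\<Gamma> C) (e C) (\<lambda>r. g r C) (h \<circ> coord_inv C) (coord C x0)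
    \<longleftrightarrow>
    (\<exists>\<nu> :: 'm \<Rightarrow> nat.
       vector_relative_half_degree (coord_range C) (e C) (\<lambda>r. g r C) (h \<circ> coord_inv C)
         (coord C x0) \<nu> \<and>
       covariantly_constant_differentials (coord_range C) (\<Gamma> C) (e C) (h \<circ> coord_inv C)
         (coord C x0) \<nu>)"
proof -
  interpret mechanical_chart "coord_range C" "\<Gamma> C" "e C" "\<lambda>r. g r C" "h \<circ> coord_inv C"
  proof
    show "open (coord_range C)"
      using assms(1,6) by (simp add: smooth_manifold_def)
    show "smooth_on (coord_range C) (\<Gamma> C)"
      and "\<And>x i j k. x \<in> coord_range C \<Longrightarrow> \<Gamma> C x $ i $ j $ k = \<Gamma> C x $ i $ k $ j"
      using assms(2,6) by (simp_all add: symmetric_affine_connection_def)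
    show "smooth_on (coord_range C) (e C)" "\<And>r. smooth_on (coord_range C) (g r C)"
      using assms(3,4,6) by (simp_all add: vector_field_def)
    show "smooth_on (coord_range C) (h \<circ> coord_inv C)"
      using assms(5,6) by (simp add: smooth_map_on_manifold_def)
  qed
  show ?thesis
    using MIOLD_solvable_imp_conditions conditions_imp_MIOLD_solvable by blast
qed

end
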